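(* Let $\Lambda$ be the Leech lattice in $\mathbb{R}^{24}$ and let $\Lambda_{276}$ be the sublattice of $\Lambda$ generated by the set $\mathcal{U}_{552}$ of $276$ antipodal pairs of lattice vectors defined in the context. Then there exists an $8$-dimensional subspace $W$ of $\mathbb{R}^{24}$ such that the orthogonal projection of $\Lambda_{276}$ onto $W$ can be identified with the $E_8$ lattice (that is, after rescaling by a suitable positive factor it is isometric to the $E_8$ lattice).
   Context: The Leech lattice is taken in Conway's (unscaled) coordinates: $\Lambda$ consists of the vectors $x=(x_1,\dots,x_{24})\in\mathbb{Z}^{24}$ for which there is $m\in\{0,1\}$ with $x_i\equiv m \pmod 2$ for all $i$, $\sum_i x_i\equiv 4m\pmod 8$, and for each residue $k$ modulo $4$ with $k\equiv m \pmod 2$, the set of coordinates $i$ with $x_i\equiv k\pmod 4$ is a codeword (viewed as a subset of the coordinates) of the extended binary Golay code of length $24$. With $x\cdot y=\sum_i x_iy_i$, let $\Lambda(n)=\{x\in\Lambda: x\cdot x=16n\}$; so $\Lambda(2)$ is the set of minimal norm vectors of $\Lambda$. Fix a vector $v\in\Lambda(3)$; since $\operatorname{Aut}(\Lambda)$ acts transitively on $\Lambda(3)$ one may take $v=(5,1,1,\dots,1)$. There are exactly $276$ unordered pairs $\{y,z\}$ of vectors of $\Lambda(2)$ with $v=y+z$. Define $$\mathcal{U}_{552}=\{\pm(y-z)\,:\, y,z\in\Lambda(2),\ v=y+z\}.$$ It consists of $276$ antipodal pairs of vectors of $\Lambda(5)$ which are orthogonal to $v$ and span $276$ equiangular lines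 in $v^\perp\cong\mathbb{R}^{23}$. *)

theory Defs
  imports
    "HOL-Analysis.Analysis"
    "HOL-Library.Z2"
    "HOL-Computational_Algebra.Group_Closure"
    "HOL-Number_Theory.Number_Theory"
begin

text \<open>
  Coordinates are indexed by the numeral type \<open>24\<close>, whose elements are
  \<open>of_nat 0, \<dots>, of_nat 23\<close>.  The elements \<open>of_nat 0, \<dots>, of_nat 22\<close> stand for the
  residues modulo 23 and \<open>of_nat 23\<close> for the point at infinity of the projective line
  over the field with 23 elements.

  The extended binary Golay code is the extended quadratic residue code: the binary linear
  code spanned by the all-ones word and the words supported on
  \<open>{n + i | n non-residue modulo 23} \<union> {\<infinity>}\<close> for \<open>i\<close> modulo 23.
\<close>

definition nonresidues23 :: "nat set" where
  "nonresidues23 = {n. n < 23 \<and> \<not> QuadRes 23 (int n)}"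

definition golay_support :: "nat \<Rightarrow> 24 set" where
  "golay_support i = of_nat ` insert 23 ((\<lambda>n. (n + i) mod 23) ` nonresidues23)"

definition char_word :: "24 set \<Rightarrow> bit ^ 24" where
  "char_word S = (\<chi> j. if j \<in> S then 1 else 0)"

definition golay_code :: "(bit ^ 24) set" where
  "golay_code = vec.span (insert (char_word UNIV) ((\<lambda>i. char_word (golay_support i)) ` {..<23}))"

definition leech_lattice :: "(real ^ 24) set" where
  "leech_lattice =
    {x. \<exists>(a :: int ^ 24) (m :: int).
          (\<forall>i. x $ i = of_int (a $ i)) \<and>
          m \<in> {0, 1} \<and>
          (\<forall>i. [a $ i = m] (mod 2)) \<and>
          [(\<Sum>i\<in>UNIV. a $ i) = 4 * m] (mod 8) \<and>
          (\<forall>k. [k = m] (mod 2) \<longrightarrow> char_word {i. [a $ i = k] (mod 4)} \<in> golay_code)}"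

definition leech_shell :: "nat \<Rightarrow> (real ^ 24) set" where
  "leech_shell n = {x \<in> leech_lattice. x \<bullet> x = 16 * real n}"

definition U552 :: "real ^ 24 \<Rightarrow> (real ^ 24) set" where
  "U552 v = {u. \<exists>y \<in> leech_shell 2. \<exists>z \<in> leech_shell 2.
                  v = y + z \<and> (u = y - z \<or> u = - (y - z))}"

definition lattice276 :: "real ^ 24 \<Rightarrow> (real ^ 24) set" where
  "lattice276 v = group_closure (U552 v)"

text \<open>
  The \<open>E\<^sub>8\<close> lattice: all coordinates integers or all coordinates in \<open>\<int> + 1/2\<close>, with
  even coordinate sum.
\<close>

definition E8_lattice :: "(real ^ 8) set" where
  "E8_lattice =
    {x. ((\<forall>i. x $ i \<in> \<int>) \<or> (\<forall>i. x $ i - 1 / 2 \<in> \<int>)) \<and>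
        (\<exists>k :: int. (\<Sum>i\<in>UNIV. x $ i) = 2 * of_int k)}"

definition orthogonal_projection :: "'a :: euclidean_space set \<Rightarrow> 'a \<Rightarrow> 'a" where
  "orthogonal_projection W x = (THE y. y \<in> W \<and> (\<forall>w\<in>W. orthogonal (x - y) w))"

text \<open>
  Isometry of lattices in possibly different Euclidean spaces: a linear isometry between
  their real spans that maps one lattice onto the other.
\<close>

definition lattice_isometric ::
  "'a :: euclidean_space set \<Rightarrow> 'b :: euclidean_space set \<Rightarrow> bool" where
  "lattice_isometric L M \<longleftrightarrow>
    (\<exists>f. linear f \<and> (\<forall>x \<in> span L. norm (f x) = norm x) \<and> f ` L = M)"

end

theory Submission
  imports Defs
begin

text \<open>
  If \<open>v\<close> vanishes on an octad \<open>O\<close>, then \<open>W = \<real>\<^sup>O\<close> works: the generators \<open>y - z = 2y - v\<close> project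
  to \<open>2y\<close> restricted to \<open>O\<close>, and the restriction of the Leech lattice to \<open>O\<close> is \<open>2 E\<^sub>8\<close>, which is
  already generated by the minimal vectors \<open>y\<close> with \<open>y \<bullet> v = 24\<close>; nine of them suffice.

  An arbitrary \<open>v\<close> is moved to such a vector by automorphisms.  If all coordinates of \<open>v\<close> are even,
  a translate of \<open>v\<close> has an odd half-sum over some tetrad of a fixed sextet, and the automorphism
  attached to the sextet makes all coordinates odd.  If they are odd, a sign change makes them
  congruent to 1 modulo 4, which leaves only the shapes \<open>(5, 1\<^sup>2\<^sup>3)\<close> and \<open>((-3)\<^sup>3, 1\<^sup>2\<^sup>1)\<close>.  The group
  \<open>PSL\<^sub>2(23)\<close> is transitive on points and on 3-element sets, and the sextet automorphism takes one shape to the other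
  up to sign.
\<close>

subsection \<open>The binary Golay code\<close>

text \<open>For \<open>y\<close> of norm 32 and \<open>v\<close> of norm 48, the difference
  \<open>v - y\<close> has norm 32 exactly when the inner product of \<open>y\<close> and
  \<open>v\<close> is 24; this is where that number comes from. All generators \<open>2y - v\<close>
  share the shift \<open>-v\<close>, which would spoil a direct comparison with the lattice of the
  \<open>y\<close>; it disappears on a subspace orthogonal to \<open>v\<close>. The vector
  (5,1,...,1) has no zero coordinate, so no coordinate subspace will do, and a vector of shape (4,
  (\<plusminus>2)^8, 0^15) takes its place; (5,1,...,1) is only the meeting point to which both this
  vector and the given \<open>v\<close> are moved. Writing lattice vectors as \<open>m + 2c\<close>,
  with \<open>c\<close> modulo 2 a codeword, makes the match with E8 visible: half of such a vector
  is \<open>m/2 + c\<close>, and the sum of \<open>c\<close> over an octad is even because the code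
  is self-orthogonal. The generators carry another factor 2, so the rescaling is by 1/4. Concrete
  memberships in the code are settled by exhibiting sums of the 23 generating rows and evaluating
  them on lists.\<close>

lemma nonresidues23_eq: "nonresidues23 = set [5,7,10,11,14,15,17,19,20,21,22]"
proof -
  \<comment> \<open>A square root may be reduced modulo 23, which turns solvability into a finite
    search.\<close>
  have QR: "QuadRes 23 a \<longleftrightarrow> list_ex (\<lambda>y. y^2 mod 23 = a mod 23) [0..22]" for a :: int
  proof
    assume "QuadRes 23 a"
    then obtain y where "[y^2 = a] (mod 23)"
      by (auto simp: QuadRes_def)
    then have "(y mod 23)^2 mod 23 = a mod 23"
      by (simp add: cong_def power_mod)
    moreover have "y mod 23 \<in> {0..22}"
      by auto
    ultimately show "list_ex (\<lambda>y. y^2 mod 23 = a mod 23) [0..22]"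
      unfolding list_ex_iff by (metis set_upto)
  qed (auto simp: QuadRes_def list_ex_iff cong_def)
  let ?N = "[5,7,10,11,14,15,17,19,20,21,22] :: nat list"
  have "list_all (\<lambda>n. (\<not> list_ex (\<lambda>y. y^2 mod 23 = int n mod 23) [0..22]) \<longleftrightarrow> n \<in> set ?N) [0..<23]"
    by code_simp
  then have "nonresidues23 = {n. n < 23 \<and> n \<in> set ?N}"
    unfolding nonresidues23_def QR list_all_iff by (metis (lifting) atLeast_upt lessThan_iff)
  moreover have "list_all (\<lambda>n. n < 23) ?N"
    by simp
  ultimately show ?thesis
    unfolding list_all_iff by blast
qed

text \<open>Evaluation takes place on lists indexed by naturals; \<open>idx\<close> links them to
  the coordinate type \<open>24\<close>, with 23 standing for the point at infinity.\<close>

definition idx :: "24 \<Rightarrow> nat" where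
  "idx i = inv_into {..<24} of_nat i"

lemma bij_of_nat_24: "bij_betw (of_nat :: nat \<Rightarrow> 24) {..<24} UNIV"
proof -
  have inj: "inj_on (of_nat :: nat \<Rightarrow> 24) {..<24}"
    by (intro inj_onI) (simp add: of_nat_eq_iff_cong_CHAR cong_def)
  then have "(of_nat :: nat \<Rightarrow> 24) ` {..<24} = UNIV"
    by (intro card_eq_UNIV_imp_eq_UNIV) (simp_all add: card_image)
  with inj show ?thesis
    by (simp add: bij_betw_def)
qed

lemma idx_of_nat [simp]: "n < 24 \<Longrightarrow> idx (of_nat n) = n"
  using bij_of_nat_24 by (simp add: idx_def bij_betw_def)

lemma of_nat_idx [simp]: "of_nat (idx i) = i"
  using bij_of_nat_24 by (simp add: idx_def bij_betw_def f_inv_into_f)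

lemma idx_less [simp]: "idx i < 24"
  using bij_of_nat_24 unfolding idx_def bij_betw_def by (metis UNIV_I inv_into_into lessThan_iff)

lemma idx_eq_iff: "idx i = idx j \<longleftrightarrow> i = j"
  by (metis of_nat_idx)

lemma sum_24: "(\<Sum>i\<in>UNIV. f (idx i)) = (\<Sum>n<24. f n)"
  by (subst sum.reindex_bij_betw[OF bij_of_nat_24, symmetric]) simp

lemma of_int_bit: "(of_int n :: bit) = of_bool (odd n)"
proof (cases "even n")
  case True
  then show ?thesis by (auto elim!: evenE)
next
  case False
  then show ?thesis by (auto elim!: oddE)
qed

text \<open>Codewords are carried as integer functions read modulo 2, so the half-coordinates of a
  lattice vector can be used as they are, and parities of integer sums express code
  properties.\<close>

definition word :: "(24 \<Rightarrow> int) \<Rightarrow> bit ^ 24" where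
  "word c = (\<chi> i. of_int (c i))"

lemma word_nth [simp]: "word c $ i = of_bool (odd (c i))"
  by (simp add: word_def of_int_bit)

lemma word_add: "word (\<lambda>i. c i + d i) = word c + word d"
  by (simp add: vec_eq_iff word_def)

lemma word_diff: "word (\<lambda>i. c i - d i) = word c - word d"
  by (simp add: vec_eq_iff word_def)

lemma word_cong: "(\<And>i. even (c i) \<longleftrightarrow> even (d i)) \<Longrightarrow> word c = word d"
  by (simp add: vec_eq_iff)

lemma char_word_eq_word: "char_word S = word (\<lambda>i. of_bool (i \<in> S))"
  by (simp add: vec_eq_iff char_word_def)

lemma golay_code_add: "x \<in> golay_code \<Longrightarrow> y \<in> golay_code \<Longrightarrow> x + y \<in> golay_code"
  and golay_code_diff: "x \<in> golay_code \<Longrightarrow> y \<in> golay_code \<Longrightarrow> x - y \<in> golay_code"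
  and golay_code_0: "0 \<in> golay_code"
  by (auto simp: golay_code_def intro: vec.span_add vec.span_diff vec.span_zero)

lemma word_const_in_golay: "word (\<lambda>i. k) \<in> golay_code"
proof (cases "even k")
  case True
  then have "word (\<lambda>i. k) = 0" by (simp add: vec_eq_iff)
  then show ?thesis by (simp add: golay_code_0)
next
  case False
  then have "word (\<lambda>i. k) = char_word UNIV" by (simp add: vec_eq_iff char_word_def)
  then show ?thesis by (auto simp: golay_code_def intro!: vec.span_base)
qed

section \<open>Evaluation of Golay words on Boolean lists\<close>

definition bool_word :: "bool list \<Rightarrow> bit ^ 24" where
  "bool_word l = (\<chi> i. of_bool (l ! idx i))"

definition xor_list :: "bool list \<Rightarrow> bool list \<Rightarrow> bool list" where
  "xor_list = map2 (\<noteq>)"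

lemma length_xor_list [simp]: "length (xor_list k l) = min (length k) (length l)"
  by (simp add: xor_list_def)

lemma bool_word_xor_list:
  "length k = 24 \<Longrightarrow> length l = 24 \<Longrightarrow> bool_word (xor_list k l) = bool_word k + bool_word l"
  by (auto simp: vec_eq_iff bool_word_def xor_list_def)

lemma bool_word_map: "bool_word (map P [0..<24]) = word (\<lambda>i. of_bool (P (idx i)))"
  by (simp add: vec_eq_iff bool_word_def)

definition nonres_row :: "bool list" where
  "nonres_row = map (\<lambda>n. n \<in> set [5,7,10,11,14,15,17,19,20,21,22]) [0..22::int]"

lemma length_nonres_row [simp]: "length nonres_row = 23"
  by (simp add: nonres_row_def)

text \<open>Translation by \<open>i\<close> modulo 23 is a rotation of the nonresidue row to the
  right; the final \<open>True\<close> is the point at infinity.\<close>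

definition gen_row :: "nat \<Rightarrow> bool list" where
  "gen_row i = drop (23 - i) nonres_row @ take (23 - i) nonres_row @ [True]"

lemma length_gen_row [simp]: "i < 23 \<Longrightarrow> length (gen_row i) = 24"
  by (simp add: gen_row_def)

lemma gen_row_nth:
  assumes "i < 23" "j < 23"
  shows "gen_row i ! j \<longleftrightarrow> (j + 23 - i) mod 23 \<in> nonresidues23"
proof -
  have nr: "nonres_row = map (\<lambda>n. n \<in> nonresidues23) [0..<23]"
    unfolding nonresidues23_eq by code_simp
  show ?thesis
  proof (cases "j < i")
    case True
    then have "(j + 23 - i) mod 23 = 23 - i + j" using assms by simp
    moreover have "\<not> j < 0" "j < 23" "23 - (23 - i) = i" "j < 23 - (23 - i)" using True assms by auto
    ultimately show ?thesis unfolding gen_row_def nr using True assms by (simp add: nth_append)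
  next
    case False
    define k where "k = j - i"
    have j: "j = i + k" "k + i < 23" using False assms by (auto simp: k_def)
    then have "(j + 23 - i) mod 23 = k" "k < 23 - i" by auto
    then show ?thesis unfolding gen_row_def nr using j assms by (simp add: nth_append)
  qed
qed

lemma gen_row_23: "i < 23 \<Longrightarrow> gen_row i ! 23"
  by (simp add: gen_row_def nth_append)

lemma golay_support_iff:
  assumes "i < 23"
  shows "j \<in> golay_support i \<longleftrightarrow> gen_row i ! idx j"
proof -
  let ?S = "insert 23 ((\<lambda>n. (n + i) mod 23) ` nonresidues23)"
  have S: "?S \<subseteq> {..<24}" by (auto intro: less_trans[OF mod_less_divisor])
  have "j \<in> golay_support i \<longleftrightarrow> idx j \<in> ?S"
    unfolding golay_support_def
  proof
    assume "j \<in> of_nat ` ?S"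
    then obtain n where "n \<in> ?S" "j = of_nat n" by blast
    then show "idx j \<in> ?S" using S idx_of_nat by (metis lessThan_iff subsetD)
  next
    assume "idx j \<in> ?S"
    then show "j \<in> of_nat ` ?S" by (metis imageI of_nat_idx)
  qed
  also have "\<dots> \<longleftrightarrow> gen_row i ! idx j"
  proof (cases "idx j = 23")
    case True
    then show ?thesis using assms by (simp add: gen_row_23)
  next
    case False
    then have j: "idx j < 23" using idx_less[of j] by linarith
    have "idx j \<in> (\<lambda>n. (n + i) mod 23) ` nonresidues23 \<longleftrightarrow> (idx j + 23 - i) mod 23 \<in> nonresidues23"
    proof
      assume "idx j \<in> (\<lambda>n. (n + i) mod 23) ` nonresidues23"
      then obtain n where n: "n \<in> nonresidues23" "idx j = (n + i) mod 23" by blast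
      then have "n < 23" by (simp add: nonresidues23_def)
      then have "((n + i) mod 23 + 23 - i) mod 23 = n"
        using assms by (cases "n + i < 23") (simp_all add: mod_if)
      then show "(idx j + 23 - i) mod 23 \<in> nonresidues23" using n by simp
    next
      assume "(idx j + 23 - i) mod 23 \<in> nonresidues23"
      moreover have "((idx j + 23 - i) mod 23 + i) mod 23 = idx j"
        using j assms by (simp add: mod_add_left_eq)
      ultimately show "idx j \<in> (\<lambda>n. (n + i) mod 23) ` nonresidues23" by (intro rev_image_eqI) auto
    qed
    then show ?thesis using False assms j by (simp add: gen_row_nth)
  qed
  finally show ?thesis .
qed

lemma char_word_golay_support: "i < 23 \<Longrightarrow> char_word (golay_support i) = bool_word (gen_row i)"
  by (simp add: vec_eq_iff char_word_def bool_word_def golay_support_iff)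

definition xor_rows :: "nat list \<Rightarrow> bool list" where
  "xor_rows I = foldr (\<lambda>i. xor_list (gen_row i)) I (replicate 24 False)"

lemma bool_word_xor_rows:
  assumes "set I \<subseteq> {..<23}"
  shows "length (xor_rows I) = 24 \<and> bool_word (xor_rows I) = (\<Sum>i\<leftarrow>I. bool_word (gen_row i))"
  using assms
proof (induction I)
  case Nil
  then show ?case by (simp add: xor_rows_def bool_word_def vec_eq_iff)
next
  case (Cons i I)
  have "xor_rows (i # I) = xor_list (gen_row i) (xor_rows I)" by (simp add: xor_rows_def)
  then show ?case using Cons by (simp add: bool_word_xor_list)
qed

text \<open>The list \<open>I\<close> is a certificate: it names the generators whose sum is the word.\<close>

definition golay_cert :: "nat list \<Rightarrow> bool list \<Rightarrow> bool" where
  "golay_cert I l \<longleftrightarrow> list_all (\<lambda>i. i < 23) I \<and> xor_rows I = l"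

lemma golay_certD:
  assumes "golay_cert I l"
  shows "bool_word l \<in> golay_code"
proof -
  have I: "set I \<subseteq> {..<23}" and l: "l = xor_rows I"
    using assms by (auto simp: golay_cert_def list_all_iff)
  have "(\<Sum>i\<leftarrow>I. bool_word (gen_row i)) \<in> golay_code"
    using I
  proof (induction I)
    case (Cons i I)
    then have "bool_word (gen_row i) \<in> golay_code"
      using char_word_golay_support[of i, symmetric]
      unfolding golay_code_def by (intro vec.span_base) auto
    then show ?case using Cons by (simp add: golay_code_add)
  qed (simp add: golay_code_0)
  then show ?thesis using bool_word_xor_rows[OF I] l by simp
qed

text \<open>The all-ones word is redundant as a generator: every finite coordinate lies in 11 of the
  23 rows and infinity in all 23, both odd, so the rows add up to it. Over \<open>bit\<close> the
  only nonzero scalar is 1, so adding one row at a time reaches every codeword.\<close>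

lemma golay_code_induct [consumes 1, case_names zero add]:
  assumes "w \<in> golay_code"
    and "P 0"
    and "\<And>i w. i < 23 \<Longrightarrow> w \<in> golay_code \<Longrightarrow> P w \<Longrightarrow> P (bool_word (gen_row i) + w)"
  shows "P w"
proof -
  let ?S = "(\<lambda>i. bool_word (gen_row i)) ` {..<23}"
  have "char_word UNIV = bool_word (replicate 24 True)"
    by (simp add: vec_eq_iff char_word_def bool_word_def)
  also have "replicate 24 True = xor_rows [0..<23]"
    by code_simp
  also have "bool_word (xor_rows [0..<23]) = (\<Sum>i\<leftarrow>[0..<23]. bool_word (gen_row i))"
    by (subst bool_word_xor_rows) auto
  also have "\<dots> = (\<Sum>i<23. bool_word (gen_row i))"
    by (simp add: sum_list_distinct_conv_sum_set atLeast_upt)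
  finally have onesum: "char_word UNIV = (\<Sum>i<23. bool_word (gen_row i))" .
  have "golay_code = vec.span (insert (char_word UNIV) ?S)"
    unfolding golay_code_def using char_word_golay_support by (metis (no_types, lifting) image_cong lessThan_iff)
  also have "\<dots> = vec.span ?S"
    unfolding onesum by (intro vec.span_redundant vec.span_sum vec.span_base) auto
  finally have span: "golay_code = vec.span ?S" .
  from assms(1) have "w \<in> vec.span ?S" by (simp add: span)
  then have "P w \<and> w \<in> golay_code"
  proof (induction rule: vec.span_induct_alt)
    case base
    then show ?case using assms(2) golay_code_0 by simp
  next
    case (step k x y)
    then obtain i where i: "i < 23" "x = bool_word (gen_row i)" by auto
    have x: "x \<in> golay_code" using step(1) by (simp add: span vec.span_base)
    show ?case
    proof (cases k)
      case zero
      then show ?thesis using step by simp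
    next
      case one
      then show ?thesis using step i x assms(3)[of i y] by (simp add: golay_code_add)
    qed
  qed
  then show ?thesis by simp
qed

section \<open>Self-orthogonality and weights divisible by four\<close>

lemma sum_nth_idx:
  fixes f :: "'a \<Rightarrow> 'b :: comm_monoid_add"
  assumes "length l = 24"
  shows "(\<Sum>i\<in>UNIV. f (l ! idx i)) = (\<Sum>x\<leftarrow>l. f x)"
  using assms sum_24[of "\<lambda>n. f (l ! n)"] by (simp add: sum_list_sum_nth atLeast0LessThan)

definition xor_all :: "bool list \<Rightarrow> bool" where
  "xor_all l = foldr (\<noteq>) l False"

lemma xor_all_sum: "(\<Sum>b\<leftarrow>l. of_bool b) = (of_bool (xor_all l) :: bit)"
proof (induction l)
  case (Cons b l)
  then show ?case by (cases b) (simp_all add: xor_all_def)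
qed (simp add: xor_all_def)

lemma gen_row_orth:
  assumes "i < 23" "k < 23"
  shows "(\<Sum>j\<in>UNIV. bool_word (gen_row i) $ j * bool_word (gen_row k) $ j) = 0"
proof -
  have "list_all (\<lambda>r. list_all (\<lambda>s. \<not> xor_all (map2 (\<and>) r s)) (map gen_row [0..<23])) (map gen_row [0..<23])"
    by code_simp
  then have "\<not> xor_all (map2 (\<and>) (gen_row i) (gen_row k))"
    using assms by (simp add: list_all_iff)
  then have 0: "(of_bool (xor_all (map2 (\<and>) (gen_row i) (gen_row k))) :: bit) = 0"
    by simp
  have "(\<Sum>j\<in>UNIV. bool_word (gen_row i) $ j * bool_word (gen_row k) $ j) =
      (\<Sum>j\<in>UNIV. of_bool (map2 (\<and>) (gen_row i) (gen_row k) ! idx j))"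
    using assms by (intro sum.cong) (auto simp: bool_word_def)
  also have "\<dots> = (\<Sum>b\<leftarrow>map2 (\<and>) (gen_row i) (gen_row k). of_bool b)"
    using assms by (intro sum_nth_idx) simp
  finally show ?thesis
    unfolding xor_all_sum 0 .
qed

lemma golay_code_orth:
  assumes "x \<in> golay_code" "y \<in> golay_code"
  shows "(\<Sum>j\<in>UNIV. x $ j * y $ j) = 0"
  using assms(1)
proof (induction rule: golay_code_induct)
  case (add i x)
  have "(\<Sum>j\<in>UNIV. bool_word (gen_row i) $ j * y $ j) = 0"
    using assms(2)
  proof (induction rule: golay_code_induct)
    case (add k y)
    then show ?case
      using gen_row_orth[OF \<open>i < 23\<close> \<open>k < 23\<close>]
      by (simp only: vector_add_component distrib_left sum.distrib add_0)
  qed simp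
  with add show ?case by (simp only: vector_add_component distrib_right sum.distrib add_0)
qed simp

text \<open>Self-orthogonality for integer representatives. This parity makes sign changes and the
  sextet map preserve the lattice, and later places octad restrictions in
  \<open>E8_lattice\<close>.\<close>

lemma golay_even_product:
  assumes "word c \<in> golay_code" "word d \<in> golay_code"
  shows "even (\<Sum>i\<in>UNIV. c i * d i)"
proof -
  have "(of_int (\<Sum>i\<in>UNIV. c i * d i) :: bit) = (\<Sum>j\<in>UNIV. word c $ j * word d $ j)"
    unfolding of_int_sum by (simp add: word_def)
  also have "\<dots> = 0" using golay_code_orth[OF assms] .
  finally show ?thesis by (simp add: of_int_bit split: if_splits)
qed

text \<open>The weight of \<open>g + w\<close> is the sum of the weights minus twice the size of the
  overlap. Each row \<open>g\<close> has weight 12 and overlaps are even, so divisibility by 4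
  survives the addition of a row.\<close>

lemma golay_weight_dvd_4:
  assumes "w \<in> golay_code"
  shows "4 dvd (\<Sum>i\<in>UNIV. of_bool (w $ i = 1) :: int)"
  using assms
proof (induction rule: golay_code_induct)
  case (add i w)
  let ?g = "bool_word (gen_row i)"
  have g: "?g \<in> golay_code"
    using char_word_golay_support[OF add(1), symmetric] add(1)
    unfolding golay_code_def by (intro vec.span_base) auto
  have "list_all (\<lambda>r. sum_list (map (\<lambda>b. if b then 1 else 0 :: int) r) = 12) (map gen_row [0..<23])"
    by code_simp
  then have "(\<Sum>b\<leftarrow>gen_row i. if b then 1 else 0 :: int) = 12"
    using add(1) by (simp add: list_all_iff)
  moreover have "(\<Sum>j\<in>UNIV. of_bool (?g $ j = 1) :: int) = (\<Sum>j\<in>UNIV. (if gen_row i ! idx j then 1 else 0))"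
    by (intro sum.cong) (auto simp: bool_word_def)
  ultimately have wg: "(\<Sum>j\<in>UNIV. of_bool (?g $ j = 1) :: int) = 12"
    using add(1) sum_nth_idx[of "gen_row i" "\<lambda>b. if b then 1 else 0 :: int"] by simp
  have "word (\<lambda>j. of_bool (?g $ j = 1)) = ?g" "word (\<lambda>j. of_bool (w $ j = 1)) = w"
    by (simp_all add: vec_eq_iff)
  then have "even (\<Sum>j\<in>UNIV. of_bool (?g $ j = 1) * of_bool (w $ j = 1) :: int)"
    using g add(2) by (intro golay_even_product) (simp_all only:)
  then obtain r where r: "(\<Sum>j\<in>UNIV. of_bool (?g $ j = 1) * of_bool (w $ j = 1) :: int) = 2 * r" ..
  have "(of_bool ((?g + w) $ j = 1) :: int) =
      of_bool (?g $ j = 1) + of_bool (w $ j = 1) - 2 * (of_bool (?g $ j = 1) * of_bool (w $ j = 1))" for j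
    by (cases "?g $ j"; cases "w $ j") auto
  then have "(\<Sum>j\<in>UNIV. of_bool ((?g + w) $ j = 1) :: int) = 12 + (\<Sum>j\<in>UNIV. of_bool (w $ j = 1)) - 2 * (2 * r)"
    by (simp only: sum.distrib sum_subtractf wg r flip: sum_distrib_left)
  then show ?case using add(3) by (auto elim!: dvdE)
qed simp

lemma golay_weight_word:
  assumes "word c \<in> golay_code"
  shows "4 dvd (\<Sum>i\<in>UNIV. of_bool (odd (c i)) :: int)"
  using golay_weight_dvd_4[OF assms] by simp

subsection \<open>Coordinates of Leech lattice vectors\<close>

text \<open>With coordinates \<open>m + 2 * c i\<close>, those congruent to \<open>m + 2 * l\<close>
  modulo 4 form the support of \<open>c + l + 1\<close> modulo 2. As the all-ones word is in the
  code, the conditions for the two residues \<open>k\<close> collapse into one. Replacing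
  \<open>m\<close> by \<open>m + 2\<close> lowers each \<open>c i\<close> by 1 and respects the sum
  condition, so \<open>m\<close> may be any integer; this freedom is used for differences and for
  the sextet map.\<close>

lemma leech_lattice_iff:
  "x \<in> leech_lattice \<longleftrightarrow> (\<exists>m c. (\<forall>i. x $ i = of_int (m + 2 * c i)) \<and>
     4 dvd (\<Sum>i\<in>UNIV. c i) - 2 * m \<and> word c \<in> golay_code)"
proof
  assume "x \<in> leech_lattice"
  then obtain a m where a: "\<And>i. x $ i = of_int (a $ i)" "m \<in> {0, 1}" "\<And>i. [a $ i = m] (mod 2)"
    "[(\<Sum>i\<in>UNIV. a $ i) = 4 * m] (mod 8)"
    "\<And>k. [k = m] (mod 2) \<Longrightarrow> char_word {i. [a $ i = k] (mod 4)} \<in> golay_code"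
    unfolding leech_lattice_def by blast
  define c where "c i = (a $ i - m) div 2" for i
  have ac: "a $ i = m + 2 * c i" for i
    using a(3)[of i] by (auto simp: c_def cong_iff_dvd_diff)
  have "(\<Sum>i\<in>UNIV. a $ i) = 24 * m + 2 * (\<Sum>i\<in>UNIV. c i)"
    by (simp add: ac sum.distrib sum_distrib_left)
  then have "4 dvd (\<Sum>i\<in>UNIV. c i) - 2 * m"
    using a(4) unfolding cong_iff_dvd_diff by presburger
  moreover have "char_word {i. [a $ i = m + 2] (mod 4)} = word c"
  proof -
    have "[a $ i = m + 2] (mod 4) \<longleftrightarrow> odd (c i)" for i
      unfolding ac cong_iff_dvd_diff by presburger
    then show ?thesis by (simp add: char_word_eq_word vec_eq_iff)
  qed
  moreover have "char_word {i. [a $ i = m + 2] (mod 4)} \<in> golay_code"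
    by (rule a(5)) (simp add: cong_iff_dvd_diff)
  ultimately show "\<exists>m c. (\<forall>i. x $ i = of_int (m + 2 * c i)) \<and>
     4 dvd (\<Sum>i\<in>UNIV. c i) - 2 * m \<and> word c \<in> golay_code"
    using a(1) ac by (metis (no_types))
next
  assume "\<exists>m c. (\<forall>i. x $ i = of_int (m + 2 * c i)) \<and>
     4 dvd (\<Sum>i\<in>UNIV. c i) - 2 * m \<and> word c \<in> golay_code"
  then obtain m c where x: "\<And>i. x $ i = of_int (m + 2 * c i)"
    and c: "4 dvd (\<Sum>i\<in>UNIV. c i) - 2 * m" "word c \<in> golay_code" by blast
  define a :: "int ^ 24" where "a = (\<chi> i. m + 2 * c i)"
  have "(\<Sum>i\<in>UNIV. a $ i) = 24 * m + 2 * (\<Sum>i\<in>UNIV. c i)"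
    by (simp add: a_def sum.distrib sum_distrib_left)
  moreover obtain r where "(\<Sum>i\<in>UNIV. c i) - 2 * m = 4 * r"
    using c(1) ..
  moreover obtain q e where "m = 2 * q + e" and e: "m mod 2 = e"
    by (metis mult_div_mod_eq)
  ultimately have "(\<Sum>i\<in>UNIV. a $ i) - 4 * (m mod 2) = 8 * (7 * q + 3 * e + r)"
    unfolding e by (simp add: algebra_simps)
  then have sum: "[(\<Sum>i\<in>UNIV. a $ i) = 4 * (m mod 2)] (mod 8)"
    unfolding cong_iff_dvd_diff by simp
  have word: "char_word {i. [a $ i = k] (mod 4)} \<in> golay_code" if k: "[k = m mod 2] (mod 2)" for k
  proof -
    from k have "2 dvd k - m" unfolding cong_iff_dvd_diff by presburger
    then obtain l where l: "k = m + 2 * l" by (metis add_diff_cancel_left' diff_add_cancel dvdE add.commute)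
    have "[a $ i = k] (mod 4) \<longleftrightarrow> odd (c i + (l + 1))" for i
      unfolding a_def l cong_iff_dvd_diff vec_lambda_beta by presburger
    then have "char_word {i. [a $ i = k] (mod 4)} = word (\<lambda>i. c i + (l + 1))"
      by (simp add: char_word_eq_word vec_eq_iff)
    then show ?thesis
      using c(2) word_const_in_golay[of "l + 1"] by (simp only: word_add golay_code_add)
  qed
  have mod2: "[a $ i = m mod 2] (mod 2)" for i
    by (simp add: a_def cong_def)
  have "m mod 2 \<in> {0, 1}" "\<And>i. x $ i = of_int (a $ i)" by (auto simp: x a_def)
  then show "x \<in> leech_lattice"
    unfolding leech_lattice_def mem_Collect_eq
    by (intro exI[of _ a] exI[of _ "m mod 2"] conjI allI impI sum word mod2)
qed

lemma leech_latticeI: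
  assumes "\<And>i. x $ i = of_int (m + 2 * c i)" "4 dvd (\<Sum>i\<in>UNIV. c i) - 2 * m" "word c \<in> golay_code"
  shows "x \<in> leech_lattice"
  unfolding leech_lattice_iff using assms by (intro exI[of _ m] exI[of _ c]) simp

lemma leech_lattice_diff:
  assumes "x \<in> leech_lattice" "y \<in> leech_lattice"
  shows "x - y \<in> leech_lattice"
proof -
  obtain m c where x: "\<And>i. x $ i = of_int (m + 2 * c i)"
    and c: "4 dvd (\<Sum>i\<in>UNIV. c i) - 2 * m" "word c \<in> golay_code"
    using assms(1) unfolding leech_lattice_iff by blast
  obtain n d where y: "\<And>i. y $ i = of_int (n + 2 * d i)"
    and d: "4 dvd (\<Sum>i\<in>UNIV. d i) - 2 * n" "word d \<in> golay_code"
    using assms(2) unfolding leech_lattice_iff by blast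
  show ?thesis
  proof (rule leech_latticeI)
    show "word (\<lambda>i. c i - d i) \<in> golay_code"
      using c d by (simp only: word_diff golay_code_diff)
    show "4 dvd (\<Sum>i\<in>UNIV. c i - d i) - 2 * (m - n)"
      using c d unfolding sum_subtractf by presburger
    show "(x - y) $ i = of_int ((m - n) + 2 * (c i - d i))" for i
      by (simp add: x y)
  qed
qed

subsection \<open>Automorphisms of the Leech lattice\<close>

definition leech_aut :: "(real ^ 24 \<Rightarrow> real ^ 24) \<Rightarrow> bool" where
  "leech_aut g \<longleftrightarrow> orthogonal_transformation g \<and> g ` leech_lattice = leech_lattice"

lemma leech_aut_comp: "leech_aut f \<Longrightarrow> leech_aut g \<Longrightarrow> leech_aut (g \<circ> f)"
  by (simp add: leech_aut_def orthogonal_transformation_compose image_comp[symmetric] del: o_apply)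

lemma leech_aut_shell: "leech_aut g \<Longrightarrow> x \<in> leech_shell n \<Longrightarrow> g x \<in> leech_shell n"
  by (auto simp: leech_aut_def leech_shell_def orthogonal_transformation_def)

text \<open>An involution that maps the lattice into itself maps it onto itself, each vector being
  the image of its own image.\<close>

lemma leech_autI_involution:
  assumes "linear g" "\<And>x. norm (g x) = norm x" "\<And>x. g (g x) = x"
    and "\<And>x. x \<in> leech_lattice \<Longrightarrow> g x \<in> leech_lattice"
  shows "leech_aut g"
  unfolding leech_aut_def orthogonal_transformation
  using assms by (auto intro: image_eqI[of _ g "g _"])

definition flip_signs :: "(24 \<Rightarrow> bool) \<Rightarrow> real ^ 24 \<Rightarrow> real ^ 24" where
  "flip_signs S x = (\<chi> i. if S i then - x $ i else x $ i)"

text \<open>With \<open>d\<close> the indicator of \<open>S\<close>, the sign change subtracts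
  \<open>m * d + 2 * (c * d)\<close> from \<open>c\<close>. Its sum is divisible by 4 because the
  weight of \<open>d\<close> is and the product of \<open>c\<close> and \<open>d\<close> is even;
  modulo 2 it is the codeword \<open>m * d\<close>.\<close>

lemma leech_aut_flip_signs:
  assumes "word (\<lambda>i. of_bool (S i)) \<in> golay_code"
  shows "leech_aut (flip_signs S)"
proof (rule leech_autI_involution)
  show "linear (flip_signs S)"
    by (rule linearI) (auto simp: flip_signs_def vec_eq_iff)
  show "norm (flip_signs S x) = norm x" for x
    by (simp add: flip_signs_def norm_eq_sqrt_inner inner_vec_def if_distrib cong: if_cong)
  show "flip_signs S (flip_signs S x) = x" for x
    by (simp add: flip_signs_def vec_eq_iff)
  fix x assume "x \<in> leech_lattice"
  then obtain m c where x: "\<And>i. x $ i = of_int (m + 2 * c i)"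
    and c: "4 dvd (\<Sum>i\<in>UNIV. c i) - 2 * m" "word c \<in> golay_code"
    unfolding leech_lattice_iff by blast
  let ?d = "\<lambda>i. of_bool (S i) :: int"
  show "flip_signs S x \<in> leech_lattice"
  proof (rule leech_latticeI)
    show "flip_signs S x $ i = of_int (m + 2 * (c i - (m * ?d i + 2 * (c i * ?d i))))" for i
      by (simp add: flip_signs_def x)
    obtain r where r: "(\<Sum>i\<in>UNIV. c i * ?d i) = 2 * r"
      using golay_even_product[OF c(2) assms] ..
    obtain s where s: "(\<Sum>i\<in>UNIV. ?d i) = 4 * s"
      using golay_weight_word[OF assms] by (auto elim!: dvdE)
    have "(\<Sum>i\<in>UNIV. c i - (m * ?d i + 2 * (c i * ?d i))) = (\<Sum>i\<in>UNIV. c i) - (m * (4 * s) + 2 * (2 * r))"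
      by (simp only: sum_subtractf sum.distrib r s flip: sum_distrib_left)
    also have "\<dots> - 2 * m = ((\<Sum>i\<in>UNIV. c i) - 2 * m) - 4 * (m * s + r)"
      by (simp add: algebra_simps)
    finally show "4 dvd (\<Sum>i\<in>UNIV. c i - (m * ?d i + 2 * (c i * ?d i))) - 2 * m"
      using c(1) by (metis dvd_diff dvd_triv_left)
    have "word (\<lambda>i. c i - m * ?d i) \<in> golay_code"
    proof (cases "even m")
      case True
      then have "word (\<lambda>i. c i - m * ?d i) = word c" by (intro word_cong) simp
      then show ?thesis using c(2) by simp
    next
      case False
      then have "word (\<lambda>i. c i - m * ?d i) = word c + word ?d"
        unfolding word_add[symmetric] by (intro word_cong) simp
      then show ?thesis using c(2) assms by (simp only: golay_code_add)
    qed
    also have "word (\<lambda>i. c i - m * ?d i) = word (\<lambda>i. c i - (m * ?d i + 2 * (c i * ?d i)))"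
      by (intro word_cong) simp
    finally show "word (\<lambda>i. c i - (m * ?d i + 2 * (c i * ?d i))) \<in> golay_code" .
  qed
qed

section \<open>Coordinate permutations preserving the code\<close>

definition permute :: "(24 \<Rightarrow> 24) \<Rightarrow> 'a ^ 24 \<Rightarrow> 'a ^ 24" where
  "permute p x = (\<chi> i. x $ p i)"

lemma permute_nth [simp]: "permute p x $ i = x $ p i"
  by (simp add: permute_def)

lemma finite_golay_code: "finite golay_code"
proof (rule finite_subset)
  have "w = char_word {i. w $ i = 1}" for w
    by (simp add: vec_eq_iff char_word_def)
  then show "golay_code \<subseteq> range char_word"
    by blast
qed simp

text \<open>The permutation acts injectively on the finite code, hence maps it onto itself, so the
  inverse permutation preserves the code too. This gives surjectivity on the lattice.\<close>

lemma leech_aut_permute: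
  assumes "bij p" and "\<And>w. w \<in> golay_code \<Longrightarrow> permute p w \<in> golay_code"
  shows "leech_aut (permute p)"
proof -
  have pres: "permute q x \<in> leech_lattice"
    if "x \<in> leech_lattice" "bij q" "\<And>w. w \<in> golay_code \<Longrightarrow> permute q w \<in> golay_code" for q x
  proof -
    obtain m c where x: "\<And>i. x $ i = of_int (m + 2 * c i)"
      and c: "4 dvd (\<Sum>i\<in>UNIV. c i) - 2 * m" "word c \<in> golay_code"
      using \<open>x \<in> leech_lattice\<close> unfolding leech_lattice_iff by blast
    have "(\<Sum>i\<in>UNIV. c (q i)) = (\<Sum>i\<in>UNIV. c i)"
      by (rule sum.reindex_bij_betw) (use that in simp)
    moreover have "word (\<lambda>i. c (q i)) = permute q (word c)"
      by (simp add: vec_eq_iff)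
    ultimately show ?thesis
      using c that(3) by (intro leech_latticeI[of _ m "\<lambda>i. c (q i)"]) (simp_all add: x)
  qed
  obtain q where q: "bij q" "\<And>i. p (q i) = i" "\<And>i. q (p i) = i"
    using \<open>bij p\<close> by (metis bij_betw_imp_surj_on bij_imp_bij_inv inv_f_f bij_is_inj surj_f_inv_f)
  have inv: "permute q (permute p w) = w" "permute p (permute q w) = w" for w :: "'b ^ 24"
    using q by (simp_all add: vec_eq_iff)
  have "inj_on (permute p) golay_code"
    by (metis inj_onI inv(1))
  then have "permute p ` golay_code = golay_code"
    using assms(2) finite_golay_code by (intro endo_inj_surj) auto
  then have inv_pres: "permute q w \<in> golay_code" if "w \<in> golay_code" for w
    using that inv(1) by (metis imageE)
  have "orthogonal_transformation (permute p :: real ^ 24 \<Rightarrow> _)"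
    unfolding orthogonal_transformation_def
  proof (intro conjI allI)
    show "linear (permute p :: real ^ 24 \<Rightarrow> _)"
      by (rule linearI) (simp_all add: vec_eq_iff)
    show "permute p v \<bullet> permute p w = v \<bullet> w" for v w :: "real ^ 24"
      unfolding inner_vec_def permute_nth by (rule sum.reindex_bij_betw[OF \<open>bij p\<close>])
  qed
  moreover have "permute p ` leech_lattice = leech_lattice"
  proof
    show "permute p ` leech_lattice \<subseteq> leech_lattice"
      using pres assms by blast
    show "leech_lattice \<subseteq> permute p ` leech_lattice"
      using pres[OF _ q(1) inv_pres] inv(2) by (metis image_eqI subsetI)
  qed
  ultimately show ?thesis
    by (simp add: leech_aut_def)
qed

section \<open>The sextet and its automorphism\<close>

text \<open>The sextet of the tetrad \<open>{\<infinity>, 0, 1, 2}\<close>: the \<open>i\<close>-th entry is the number of the tetrad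
  containing the coordinate \<open>i\<close>.\<close>

definition sextet :: "nat list" where
  "sextet = [0,0,0,1,2,1,3,3,4,5,5,4,4,2,1,5,2,1,4,3,5,3,2,0]"

definition tet :: "24 \<Rightarrow> nat" where
  "tet i = sextet ! idx i"

definition tetrad :: "nat \<Rightarrow> 24 set" where
  "tetrad t = {i. tet i = t}"

lemma length_sextet [simp]: "length sextet = 24"
  by (simp add: sextet_def)

lemma tet_less: "tet i < 6"
proof -
  have "list_all (\<lambda>t. t < 6) sextet" by code_simp
  then show ?thesis by (simp add: tet_def list_all_length)
qed

lemma sum_tetrad_list:
  fixes f :: "nat \<Rightarrow> 'a :: comm_monoid_add"
  shows "(\<Sum>i\<in>tetrad t. f (idx i)) = (\<Sum>n\<leftarrow>filter (\<lambda>n. sextet ! n = t) [0..<24]. f n)"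
proof -
  have "(\<Sum>i\<in>tetrad t. f (idx i)) = (\<Sum>i\<in>UNIV. if sextet ! idx i = t then f (idx i) else 0)"
    by (simp add: tetrad_def tet_def sum.If_cases)
  also have "\<dots> = (\<Sum>n<24. if sextet ! n = t then f n else 0)"
    by (rule sum_24)
  also have "\<dots> = (\<Sum>n\<leftarrow>[0..<24]. if sextet ! n = t then f n else 0)"
    by (simp add: sum_list_distinct_conv_sum_set atLeast_upt)
  also have "\<dots> = (\<Sum>n\<leftarrow>filter (\<lambda>n. sextet ! n = t) [0..<24]. f n)"
    by (simp add: sum_list_map_filter')
  finally show ?thesis .
qed

lemma card_tetrad: "t < 6 \<Longrightarrow> card (tetrad t) = 4"
proof -
  assume "t < 6"
  have "list_all (\<lambda>t. sum_list (map (\<lambda>n. 1) (filter (\<lambda>n. sextet ! n = t) [0..<24])) = (4 :: nat)) [0..<6]"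
    by code_simp
  then show ?thesis
    using \<open>t < 6\<close> sum_tetrad_list[of "\<lambda>_. 1 :: nat" t] by (simp add: list_all_iff)
qed

text \<open>The tetrad 0 is split off because \<open>sextet_map\<close> treats it with the opposite
  sign and the codewords of the sextet are built from its unions with the other five.\<close>

lemma sum_by_tetrads:
  fixes f :: "24 \<Rightarrow> 'a :: comm_monoid_add"
  shows "(\<Sum>i\<in>UNIV. f i) = (\<Sum>i\<in>tetrad 0. f i) + (\<Sum>t\<in>{1..5}. \<Sum>i\<in>tetrad t. f i)"
proof -
  have "(\<Sum>i\<in>UNIV. f i) = (\<Sum>t<6. \<Sum>i\<in>tetrad t. f i)"
    using sum.group[of UNIV "{..<6}" tet f] tet_less by (simp add: tetrad_def image_subset_iff)
  also have "{..<6} = insert 0 {1..5::nat}" by auto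
  finally show ?thesis by simp
qed

lemma word_scale_in_golay: "word c \<in> golay_code \<Longrightarrow> word (\<lambda>i. k * c i) \<in> golay_code"
  using word_cong[of "\<lambda>i. k * c i" "if even k then (\<lambda>_. 0) else c"] word_const_in_golay[of 0]
  by (auto split: if_splits)

lemma word_sum_in_golay:
  assumes "finite A" "\<And>t. t \<in> A \<Longrightarrow> word (c t) \<in> golay_code"
  shows "word (\<lambda>i. \<Sum>t\<in>A. c t i) \<in> golay_code"
  using assms
  by (induction rule: finite_induct) (simp_all add: word_const_in_golay word_add golay_code_add)

lemma two_tetrads_in_golay:
  assumes "t \<in> {1..5}"
  shows "word (\<lambda>i. of_bool (tet i = 0 \<or> tet i = t)) \<in> golay_code"
proof -
  have "list_all (\<lambda>(t, I). golay_cert I (map (\<lambda>s. s = 0 \<or> s = t) sextet))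
      [(1, [0,10,12]), (2, [9,11,22]), (3, [16,19,20]), (4, [11,16,17]), (5, [2,11,21])]"
    by code_simp
  then have "bool_word (map (\<lambda>s. s = 0 \<or> s = t) sextet) \<in> golay_code"
    using assms golay_certD by (auto simp: atLeastAtMost_insertL numeral_eq_Suc le_Suc_eq)
  also have "bool_word (map (\<lambda>s. s = 0 \<or> s = t) sextet) = word (\<lambda>i. of_bool (tet i = 0 \<or> tet i = t))"
    by (simp add: vec_eq_iff bool_word_def tet_def)
  finally show ?thesis .
qed

text \<open>Take the octads formed by tetrad 0 and tetrad \<open>t\<close> with coefficients
  \<open>e t\<close>. Outside tetrad 0 this gives \<open>e\<close>; on tetrad 0 it gives the sum of
  the other five values, which has the parity of \<open>e 0\<close> by hypothesis.\<close>

lemma union_tetrads_in_golay: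
  assumes "even (e 0 + (\<Sum>t\<in>{1..5}. e t))"
  shows "word (\<lambda>i. e (tet i)) \<in> golay_code"
proof -
  have "word (\<lambda>i. \<Sum>t\<in>{1..5}. e t * of_bool (tet i = 0 \<or> tet i = t)) \<in> golay_code"
    by (intro word_sum_in_golay word_scale_in_golay two_tetrads_in_golay) auto
  also have "word (\<lambda>i. \<Sum>t\<in>{1..5}. e t * of_bool (tet i = 0 \<or> tet i = t)) = word (\<lambda>i. e (tet i))"
  proof (rule word_cong)
    fix i
    show "even (\<Sum>t\<in>{1..5}. e t * of_bool (tet i = 0 \<or> tet i = t)) \<longleftrightarrow> even (e (tet i))"
    proof (cases "tet i = 0")
      case True
      then show ?thesis using assms by simp
    next
      case False
      then have "(\<Sum>t\<in>{1..5}. e t * of_bool (tet i = 0 \<or> tet i = t)) = (\<Sum>t\<in>{1..5}. if tet i = t then e t else 0)"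
        by (intro sum.cong) auto
      also have "\<dots> = e (tet i)"
        using False tet_less[of i] by simp
      finally show ?thesis by simp
    qed
  qed
  finally show ?thesis .
qed

text \<open>Conway's automorphism attached to the sextet: on each tetrad, the reflection in the
  all-ones vector, followed by a change of sign on the first tetrad.\<close>

definition sextet_map :: "real ^ 24 \<Rightarrow> real ^ 24" where
  "sextet_map x = (\<chi> i. let h = (\<Sum>j\<in>tetrad (tet i). x $ j) / 2 in
     if tet i = 0 then h - x $ i else x $ i - h)"

lemma sextet_map_nth: "sextet_map x $ i =
    (if tet i = 0 then 1 else - 1) * ((\<Sum>j\<in>tetrad (tet i). x $ j) / 2 - x $ i)"
  by (simp add: sextet_map_def Let_def)

lemma tet_in_tetrad: "i \<in> tetrad t \<Longrightarrow> tet i = t"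
  by (simp add: tetrad_def)

text \<open>Let \<open>\<sigma> t\<close> be the sum of \<open>c\<close> over tetrad
  \<open>t\<close>. Half the tetrad sum of \<open>x\<close> is \<open>2 * m + \<sigma> t\<close>, so
  the image has new constant \<open>m + \<sigma> 0\<close> and half-coordinates \<open>- c i\<close>
  on tetrad 0 and \<open>c i - m - \<rho> t\<close> elsewhere, where \<open>\<rho> t\<close> is half
  of \<open>\<sigma> 0 + \<sigma> t\<close>. The latter is an integer because two tetrads form an
  octad, which meets \<open>c\<close> evenly. The parity of the coordinates changes exactly when
  \<open>\<sigma> 0\<close> is odd.\<close>

lemma leech_aut_sextet_map: "leech_aut sextet_map"
proof (rule leech_autI_involution)
  show "linear sextet_map"
    by (rule linearI) (simp_all add: vec_eq_iff sextet_map_nth sum.distrib algebra_simps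
        flip: sum_distrib_left)
  have sum_t: "(\<Sum>i\<in>tetrad t. sextet_map x $ i) = (if t = 0 then 1 else - 1) * (\<Sum>i\<in>tetrad t. x $ i)"
    if "t < 6" for t x
  proof -
    have "(\<Sum>i\<in>tetrad t. sextet_map x $ i) =
        (\<Sum>i\<in>tetrad t. (if t = 0 then 1 else - 1) * ((\<Sum>j\<in>tetrad t. x $ j) / 2 - x $ i))"
      by (intro sum.cong) (auto simp: sextet_map_nth dest!: tet_in_tetrad)
    also have "\<dots> = (if t = 0 then 1 else - 1) * (4 * ((\<Sum>j\<in>tetrad t. x $ j) / 2) - (\<Sum>i\<in>tetrad t. x $ i))"
      by (simp only: sum_subtractf sum_constant card_tetrad[OF that] flip: sum_distrib_left) simp
    finally show ?thesis by simp
  qed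
  show "sextet_map (sextet_map x) = x" for x
    by (simp add: vec_eq_iff sextet_map_nth[of "sextet_map x"] sum_t tet_less) (simp add: sextet_map_nth)
  have "(\<Sum>i\<in>tetrad t. sextet_map x $ i * sextet_map x $ i) = (\<Sum>i\<in>tetrad t. x $ i * x $ i)"
    if "t < 6" for t x
  proof -
    define s where "s = (\<Sum>j\<in>tetrad t. x $ j)"
    have "(\<Sum>i\<in>tetrad t. sextet_map x $ i * sextet_map x $ i) = (\<Sum>i\<in>tetrad t. s * s / 4 - s * x $ i + x $ i * x $ i)"
      by (intro sum.cong) (auto simp: sextet_map_nth s_def field_simps dest!: tet_in_tetrad)
    also have "\<dots> = 4 * (s * s / 4) - s * s + (\<Sum>i\<in>tetrad t. x $ i * x $ i)"
      by (simp only: sum.distrib sum_subtractf sum_constant card_tetrad[OF that] flip: sum_distrib_left)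
        (simp add: s_def)
    finally show ?thesis by simp
  qed
  then show "norm (sextet_map x) = norm x" for x
    unfolding norm_eq_sqrt_inner inner_vec_def inner_real_def sum_by_tetrads by simp
next
  fix x assume "x \<in> leech_lattice"
  then obtain m c where x: "\<And>i. x $ i = of_int (m + 2 * c i)"
    and c: "4 dvd (\<Sum>i\<in>UNIV. c i) - 2 * m" "word c \<in> golay_code"
    unfolding leech_lattice_iff by blast
  define \<sigma> where "\<sigma> t = (\<Sum>i\<in>tetrad t. c i)" for t
  define \<rho> where "\<rho> t = (\<sigma> 0 + \<sigma> t) div 2" for t
  have \<rho>: "\<sigma> 0 + \<sigma> t = 2 * \<rho> t" if "t \<in> {1..5}" for t
  proof -
    have "even (\<Sum>i\<in>UNIV. c i * of_bool (tet i = 0 \<or> tet i = t))"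
      using golay_even_product[OF c(2) two_tetrads_in_golay[OF that]] .
    also have "(\<Sum>i\<in>UNIV. c i * of_bool (tet i = 0 \<or> tet i = t)) = (\<Sum>i\<in>tetrad 0 \<union> tetrad t. c i)"
      by (intro sum.mono_neutral_cong_right) (auto simp: tetrad_def)
    also have "\<dots> = \<sigma> 0 + \<sigma> t"
      unfolding \<sigma>_def using that by (intro sum.union_disjoint) (auto simp: tetrad_def)
    finally show ?thesis by (simp add: \<rho>_def)
  qed
  define S where "S = (\<Sum>t\<in>{1..5}. \<sigma> t)"
  define R where "R = (\<Sum>t\<in>{1..5}. \<rho> t)"
  have sumc: "(\<Sum>i\<in>UNIV. c i) = \<sigma> 0 + S"
    by (simp add: sum_by_tetrads \<sigma>_def S_def)
  have "(\<Sum>t\<in>{1..5::nat}. \<sigma> 0 + \<sigma> t) = (\<Sum>t\<in>{1..5}. 2 * \<rho> t)"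
    by (intro sum.cong) (simp_all add: \<rho>)
  then have R: "5 * \<sigma> 0 + S = 2 * R"
    by (simp add: sum.distrib S_def R_def sum_distrib_left)
  obtain r where r: "\<sigma> 0 + S - 2 * m = 4 * r"
    using c(1) unfolding sumc ..
  \<comment> \<open>Modulo 2, \<open>e\<close> is the change from \<open>c\<close> to
    \<open>c'\<close>; it is constant on each tetrad, and its total over the six tetrads turns out
    even because of the sum condition on \<open>c\<close>.\<close>
  define e where "e t = (if t = 0 then 0 else - m - \<rho> t)" for t
  define c' where "c' i = (if tet i = 0 then - c i else c i - m - \<rho> (tet i))" for i
  show "sextet_map x \<in> leech_lattice"
  proof (rule leech_latticeI)
    have sum_x: "(\<Sum>j\<in>tetrad t. x $ j) = of_int (4 * m + 2 * \<sigma> t)" if "t < 6" for t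
      by (simp add: x \<sigma>_def sum.distrib card_tetrad[OF that] flip: sum_distrib_left)
    show "sextet_map x $ i = of_int ((m + \<sigma> 0) + 2 * c' i)" for i
    proof (cases "tet i = 0")
      case True
      then show ?thesis
        by (simp add: sextet_map_nth sum_x c'_def x[of i])
    next
      case False
      then have "tet i \<in> {1..5}" using tet_less[of i] by auto
      then have "real_of_int (\<sigma> 0 + \<sigma> (tet i)) = real_of_int (2 * \<rho> (tet i))"
        by (simp only: \<rho>)
      then show ?thesis
        using False by (simp add: sextet_map_nth sum_x tet_less c'_def x[of i] field_simps)
    qed
    have sum_c': "(\<Sum>i\<in>tetrad t. c' i) = \<sigma> t - 4 * m - 4 * \<rho> t" if "t \<in> {1..5}" for t
    proof -
      have "(\<Sum>i\<in>tetrad t. c' i) = (\<Sum>i\<in>tetrad t. c i - (m + \<rho> t))"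
        using that by (intro sum.cong) (auto simp: c'_def dest!: tet_in_tetrad)
      then show ?thesis
        using that by (simp add: sum_subtractf card_tetrad \<sigma>_def)
    qed
    have "(\<Sum>i\<in>tetrad 0. c' i) = - \<sigma> 0"
      unfolding \<sigma>_def sum_negf[symmetric] by (intro sum.cong) (auto simp: c'_def dest!: tet_in_tetrad)
    moreover have "(\<Sum>t\<in>{1..5}. \<Sum>i\<in>tetrad t. c' i) = S - 20 * m - 4 * R"
      by (simp add: sum_c' sum_subtractf S_def R_def flip: sum_distrib_left)
    ultimately have "(\<Sum>i\<in>UNIV. c' i) - 2 * (m + \<sigma> 0) = 4 * (r - \<sigma> 0 - 5 * m - R)"
      using r by (simp add: sum_by_tetrads)
    then show "4 dvd (\<Sum>i\<in>UNIV. c' i) - 2 * (m + \<sigma> 0)"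
      by (metis dvd_triv_left)
    have "(\<Sum>t\<in>{1..5}. e t) = (\<Sum>t\<in>{1..5::nat}. - m - \<rho> t)"
      by (intro sum.cong) (auto simp: e_def)
    also have "\<dots> = - 5 * m - R"
      by (simp add: sum_subtractf R_def)
    also have "R = 2 * \<sigma> 0 + m + 2 * r"
      using R r by simp
    finally have "even (e 0 + (\<Sum>t\<in>{1..5}. e t))"
      by (simp add: e_def)
    then have "word c + word (\<lambda>i. e (tet i)) \<in> golay_code"
      by (intro golay_code_add union_tetrads_in_golay c)
    also have "word c + word (\<lambda>i. e (tet i)) = word c'"
      unfolding word_add[symmetric] by (intro word_cong) (auto simp: c'_def e_def)
    finally show "word c' \<in> golay_code" .
  qed
qed

subsection \<open>Permutations of the projective line over the field with 23 elements\<close>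

definition golay_perm :: "(24 \<Rightarrow> 24) \<Rightarrow> bool" where
  "golay_perm p \<longleftrightarrow> bij p \<and> (\<forall>w\<in>golay_code. permute p w \<in> golay_code)"

lemma golay_perm_comp: "golay_perm p \<Longrightarrow> golay_perm q \<Longrightarrow> golay_perm (p \<circ> q)"
proof -
  have "permute (p \<circ> q) w = permute q (permute p w)" for w :: "bit ^ 24"
    by (simp add: vec_eq_iff)
  then show "golay_perm p \<Longrightarrow> golay_perm q \<Longrightarrow> golay_perm (p \<circ> q)"
    by (simp add: golay_perm_def bij_comp)
qed

lemma golay_perm_funpow: "golay_perm p \<Longrightarrow> golay_perm (p ^^ n)"
proof (induction n)
  case 0
  then show ?case by (simp add: golay_perm_def permute_def id_def bij_id[unfolded id_def])
qed (simp add: golay_perm_comp)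

lemma leech_aut_golay_perm: "golay_perm p \<Longrightarrow> leech_aut (permute p)"
  by (intro leech_aut_permute) (auto simp: golay_perm_def)

definition list_perm :: "nat list \<Rightarrow> 24 \<Rightarrow> 24" where
  "list_perm l i = of_nat (l ! idx i)"

definition golay_perm_cert :: "nat list \<Rightarrow> nat list list \<Rightarrow> bool" where
  "golay_perm_cert l Is \<longleftrightarrow> length l = 24 \<and> distinct l \<and> list_all (\<lambda>n. n < 24) l \<and>
     list_all (\<lambda>(i, I). golay_cert I (map (nth (gen_row i)) l)) (zip [0..<23] Is) \<and> length Is = 23"

text \<open>The action on words is additive, so it is enough that the 23 generating rows are sent
  into the code; \<open>Is\<close> holds one certificate for each row.\<close>

lemma golay_perm_certD:
  assumes "golay_perm_cert l Is"
  shows "golay_perm (list_perm l)"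
proof -
  have l: "length l = 24" "distinct l" "\<And>n. n < 24 \<Longrightarrow> l ! n < 24" "length Is = 23"
    using assms by (auto simp: golay_perm_cert_def list_all_iff)
  have cert: "golay_cert (Is ! i) (map (nth (gen_row i)) l)" if "i < 23" for i
    using assms that by (force simp: golay_perm_cert_def list_all_length)
  have "inj (list_perm l)"
  proof (rule injI)
    fix i j assume "list_perm l i = list_perm l j"
    then have "idx (list_perm l i) = idx (list_perm l j)" by simp
    then have "l ! idx i = l ! idx j" using l by (simp add: list_perm_def)
    then show "i = j" using l by (simp add: nth_eq_iff_index_eq idx_eq_iff)
  qed
  then have "bij (list_perm l)"
    by (simp add: bij_def finite_UNIV_inj_surj)
  moreover have "permute (list_perm l) w \<in> golay_code" if "w \<in> golay_code" for w
    using that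
  proof (induction rule: golay_code_induct)
    case zero
    have "permute (list_perm l) 0 = (0 :: bit ^ 24)"
      by (simp add: vec_eq_iff)
    then show ?case by (simp add: golay_code_0)
  next
    case (add i w)
    have "permute (list_perm l) (bool_word (gen_row i)) = bool_word (map (nth (gen_row i)) l)"
      using l by (simp add: vec_eq_iff bool_word_def list_perm_def)
    then have "permute (list_perm l) (bool_word (gen_row i)) \<in> golay_code"
      using golay_certD[OF cert[OF add(1)]] by simp
    moreover have "permute (list_perm l) (bool_word (gen_row i) + w) =
        permute (list_perm l) (bool_word (gen_row i)) + permute (list_perm l) w"
      by (simp add: vec_eq_iff)
    ultimately show ?case
      using add.IH by (simp add: golay_code_add)
  qed
  ultimately show ?thesis by (simp add: golay_perm_def)
qed

definition shift :: "24 \<Rightarrow> 24" where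
  "shift = list_perm ([1..<23] @ [0, 23])"

text \<open>Multiplication by 2, which is the square of 5 modulo 23 and hence maps nonresidues to
  nonresidues; it has order 11, so its powers are all the nonzero squares.\<close>

definition double :: "24 \<Rightarrow> 24" where
  "double = list_perm (map (\<lambda>n. 2 * n mod 23) [0..<23] @ [23])"

text \<open>The map \<open>x \<mapsto> -1/x\<close> on the projective line.\<close>

definition inversion :: "24 \<Rightarrow> 24" where
  "inversion = list_perm [23, 22, 11, 15, 17, 9, 19, 13, 20, 5, 16, 2, 21, 7, 18, 3, 10, 4, 14, 6, 8, 12, 1, 0]"

lemma golay_perm_shift: "golay_perm shift"
  unfolding shift_def
  by (rule golay_perm_certD[of _ "[22] # map (\<lambda>i. [i]) [0..<22]"]) code_simp

lemma golay_perm_double: "golay_perm double"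
  unfolding double_def
  \<comment> \<open>Row \<open>i\<close> becomes row \<open>i/2\<close>, and 12 is the inverse of 2
    modulo 23.\<close>
  by (rule golay_perm_certD[of _ "map (\<lambda>i. [12 * i mod 23]) [0..<23]"]) code_simp

lemma golay_perm_inversion: "golay_perm inversion"
  unfolding inversion_def
  by (rule golay_perm_certD[of _ "[[1, 5, 6, 7, 9, 11], [4, 5, 6, 8, 10], [1, 5, 6, 7, 9],
    [2, 4, 8, 12, 13], [1, 4, 10, 11, 12], [0, 9], [1, 5, 8, 12, 14], [0, 13], [2, 4, 7, 9, 10],
    [1, 6, 7, 9, 11], [0, 16], [0, 2], [1, 2, 3, 9, 12], [1, 5, 6, 9, 11], [0, 18], [0, 3],
    [3, 5, 7, 12, 13], [0, 4], [2, 3, 4, 5, 11], [0, 6], [0, 8], [0, 12], [0, 1]]"]) code_simp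

lemma shift_of_nat: "n < 23 \<Longrightarrow> shift (of_nat n) = of_nat ((n + 1) mod 23)"
  and shift_23: "shift 23 = 23"
  and double_of_nat: "n < 23 \<Longrightarrow> double (of_nat n) = of_nat (2 * n mod 23)"
  and double_23: "double 23 = 23"
  and inversion_23: "inversion 23 = 0"
proof -
  have idx: "idx (23 :: 24) = 23"
    using idx_of_nat[of 23] by simp
  show "shift 23 = 23" "double 23 = 23" "inversion 23 = 0"
    by (simp_all add: shift_def double_def inversion_def list_perm_def idx nth_append)
  assume "n < 23"
  then show "double (of_nat n) = of_nat (2 * n mod 23)"
    by (simp add: double_def list_perm_def nth_append)
  show "shift (of_nat n) = of_nat ((n + 1) mod 23)"
  proof (cases "n = 22")
    case False
    then show ?thesis using \<open>n < 23\<close> by (simp add: shift_def list_perm_def nth_append)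
  qed (use idx_of_nat[of 22] in \<open>simp add: shift_def list_perm_def nth_append\<close>)
qed

lemma shift_pow_of_nat: "n < 23 \<Longrightarrow> (shift ^^ k) (of_nat n) = of_nat ((n + k) mod 23)"
  by (induction k) (simp_all add: shift_of_nat mod_Suc_eq)

lemma double_pow_of_nat: "n < 23 \<Longrightarrow> (double ^^ k) (of_nat n) = of_nat (2 ^ k * n mod 23)"
  by (induction k) (simp_all add: double_of_nat mod_mult_right_eq mult.assoc)

lemma shift_pow_23: "(shift ^^ k) 23 = 23"
  by (induction k) (simp_all add: shift_23)

lemma double_pow_23: "(double ^^ k) 23 = 23"
  by (induction k) (simp_all add: double_23)

lemma coord_cases: obtains "i = (23 :: 24)" | n where "n < 23" "i = of_nat n"
proof (cases "idx i = 23")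
  case True
  then have "i = 23" using of_nat_idx[of i] by simp
  then show ?thesis using that by blast
next
  case False
  then have "idx i < 23" using idx_less[of i] by linarith
  then show ?thesis using that of_nat_idx by metis
qed

text \<open>The affine map with multiplier \<open>2 ^ e\<close> and translation \<open>a\<close>
  sends 0 and 1 to \<open>a\<close> and \<open>a + 2 ^ e\<close>. Since -1 is not a square modulo
  23, exactly one of \<open>b - a\<close> and \<open>a - b\<close> is a square, that is, a power of
  2. Hence only the unordered pair can be prescribed.\<close>

lemma golay_perm_2_homogeneous:
  assumes "j \<noteq> k" "j \<noteq> 23" "k \<noteq> 23"
  shows "\<exists>p. golay_perm p \<and> p 23 = 23 \<and> {p 0, p 1} = {j, k}"
proof -
  obtain a b where ab: "a < 23" "j = of_nat a" "b < 23" "k = of_nat b"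
    using assms coord_cases by metis
  have main: "\<exists>p. golay_perm p \<and> p 23 = 23 \<and> {p 0, p 1} = {of_nat a, of_nat b}"
    if "a < 23" "(a + 2 ^ e) mod 23 = b" for a b e :: nat
  proof (intro exI[of _ "(shift ^^ a) \<circ> (double ^^ e)"] conjI)
    show "golay_perm ((shift ^^ a) \<circ> (double ^^ e))"
      by (intro golay_perm_comp golay_perm_funpow golay_perm_shift golay_perm_double)
    show "((shift ^^ a) \<circ> (double ^^ e)) 23 = 23"
      by (simp add: shift_pow_23 double_pow_23)
    have "((shift ^^ a) \<circ> (double ^^ e)) 0 = of_nat a"
      using double_pow_of_nat[of 0 e] shift_pow_of_nat[of 0 a] that by simp
    moreover have "(2 ^ e mod 23 + a) mod 23 = b"
      using that by (metis add.commute mod_add_left_eq)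
    then have "((shift ^^ a) \<circ> (double ^^ e)) 1 = of_nat b"
      using double_pow_of_nat[of 1 e] shift_pow_of_nat[of "2 ^ e mod 23" a] that
      by simp
    ultimately show "{((shift ^^ a) \<circ> (double ^^ e)) 0, ((shift ^^ a) \<circ> (double ^^ e)) 1} = {of_nat a, of_nat b}"
      by simp
  qed
  have pow: "\<exists>e. d = 2 ^ e mod 23 \<or> 23 - d = 2 ^ e mod 23" if "0 < d" "d < 23" for d :: nat
  proof -
    have "list_all (\<lambda>d. list_ex (\<lambda>e. d = 2 ^ e mod 23 \<or> 23 - d = 2 ^ e mod 23) [0..<11]) [1..<23]"
      by code_simp
    then show ?thesis
      using that by (auto simp: list_all_iff list_ex_iff)
  qed
  define d where "d = (b + 23 - a) mod 23"
  have "a \<noteq> b" using assms ab by auto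
  then have d: "0 < d" "d < 23" "(a + d) mod 23 = b" "(b + (23 - d)) mod 23 = a"
    using ab by (auto simp: d_def mod_if)
  obtain e where "d = 2 ^ e mod 23 \<or> 23 - d = 2 ^ e mod 23"
    using pow d by blast
  then have "(a + 2 ^ e) mod 23 = b \<or> (b + 2 ^ e) mod 23 = a"
    using d by (metis mod_add_right_eq)
  then show ?thesis
    using main[of a e b] main[of b e a] ab by (auto simp: insert_commute)
qed

lemma golay_perm_transitive: "\<exists>p. golay_perm p \<and> p 23 = i"
proof (cases rule: coord_cases[of i])
  case 1
  then show ?thesis using golay_perm_funpow[OF golay_perm_shift, of 0] by (intro exI[of _ "shift ^^ 0"]) simp
next
  case (2 n)
  have "golay_perm ((shift ^^ n) \<circ> inversion)"
    by (intro golay_perm_comp golay_perm_funpow golay_perm_shift golay_perm_inversion)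
  moreover have "((shift ^^ n) \<circ> inversion) 23 = i"
    using shift_pow_of_nat[of 0 n] 2 by (simp add: inversion_23)
  ultimately show ?thesis by blast
qed

lemma golay_perm_3_homogeneous:
  assumes "card B = 3"
  shows "\<exists>p. golay_perm p \<and> p ` {23, 0, 1} = B"
proof -
  obtain i j k where B: "B = {i, j, k}" "i \<noteq> j" "j \<noteq> k" "i \<noteq> k"
    using assms card_3_iff[of B] by auto
  obtain p where p: "golay_perm p" "p 23 = i"
    using golay_perm_transitive by blast
  then have "bij p" by (simp add: golay_perm_def)
  then obtain j' k' where jk: "p j' = j" "p k' = k"
    by (metis bij_pointE)
  then obtain q where q: "golay_perm q" "q 23 = 23" "{q 0, q 1} = {j', k'}"
    using golay_perm_2_homogeneous[of j' k'] B p by metis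
  have "(p \<circ> q) ` {23, 0, 1} = insert (p (q 23)) (p ` {q 0, q 1})"
    by auto
  also have "\<dots> = B"
    unfolding q using p jk B by auto
  finally show ?thesis
    using golay_perm_comp[OF p(1) q(1)] by blast
qed

text \<open>Over the field with two elements, a combination of nine monomials times
  \<open>x\<^sup>3 + x\<^sup>5 + x\<^sup>1\<^sup>4 + x\<^sup>1\<^sup>7\<close> is \<open>1 + x\<close> modulo \<open>x\<^sup>2\<^sup>3 - 1\<close>.\<close>

lemma shift_parity:
  fixes f :: "nat \<Rightarrow> int"
  assumes "\<And>k. even (f ((3 + k) mod 23) + f ((5 + k) mod 23) + f ((14 + k) mod 23) + f ((17 + k) mod 23))"
    and "n < 23"
  shows "even (f n) \<longleftrightarrow> even (f 0)"
proof -
  have shift: "even (f (s mod 23)) \<longleftrightarrow> even (f (Suc s mod 23))" for s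
  proof -
    define g where "g n = f ((n + s) mod 23)" for n
    have g23: "g (n mod 23) = f ((n + s) mod 23)" for n
      by (simp add: g_def mod_add_left_eq)
    define F where "F k = g ((3 + k) mod 23) + g ((5 + k) mod 23) + g ((14 + k) mod 23) + g ((17 + k) mod 23)" for k
    have "even (F k)" for k
      unfolding F_def g23 using assms(1)[of "k + s"] by (simp only: add.assoc)
    then have "even (F 3 + F 4 + F 8 + F 12 + F 13 + F 17 + F 18 + F 21 + F 22)"
      by (intro dvd_add)
    also have "F 3 + F 4 + F 8 + F 12 + F 13 + F 17 + F 18 + F 21 + F 22 = g 0 + g 1 +
        2 * (g 2 + g 3 + g 4 + g 6 + g 7 + g 8 + g 9 + g 11 + g 12 + g 13 + g 15 + g 16 + g 17 + g 18 +
          g 20 + g 21 + g 22)"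
      by (simp add: F_def)
    finally have "even (g 0 + g 1)" by simp
    then show ?thesis by (simp add: g_def)
  qed
  have "even (f (n mod 23)) \<longleftrightarrow> even (f 0)"
    by (induction n) (simp_all flip: shift)
  then show ?thesis using assms(2) by simp
qed

subsection \<open>Transitivity on the third shell\<close>

lemma sum_24_of_nat: "(\<Sum>i\<in>UNIV. f i) = (\<Sum>n<23. f (of_nat n)) + f (23 :: 24)"
proof -
  have "(\<Sum>i\<in>UNIV. f i) = (\<Sum>n<24. f (of_nat n))"
    by (rule sum.reindex_bij_betw[OF bij_of_nat_24, symmetric])
  also have "{..<24} = insert 23 {..<23::nat}" by auto
  finally show ?thesis by (simp add: add.commute)
qed

definition one_five :: "24 \<Rightarrow> real ^ 24" where
  "one_five i = (\<chi> j. if j = i then 5 else 1)"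

definition minus_threes :: "24 set \<Rightarrow> real ^ 24" where
  "minus_threes B = (\<chi> j. if j \<in> B then - 3 else 1)"

definition leech_equiv :: "real ^ 24 \<Rightarrow> real ^ 24 \<Rightarrow> bool" where
  "leech_equiv x y \<longleftrightarrow> (\<exists>g. leech_aut g \<and> g x = y)"

lemma leech_equiv_trans: "leech_equiv x y \<Longrightarrow> leech_equiv y z \<Longrightarrow> leech_equiv x z"
  unfolding leech_equiv_def by (metis comp_apply leech_aut_comp)

lemma leech_equivI: "leech_aut g \<Longrightarrow> leech_equiv x (g x)"
  by (auto simp: leech_equiv_def)

lemma leech_equiv_shell: "leech_equiv x y \<Longrightarrow> x \<in> leech_shell n \<Longrightarrow> y \<in> leech_shell n"
  by (auto simp: leech_equiv_def leech_aut_shell)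

lemma one_five_equiv: "leech_equiv (one_five i) (one_five 23)"
proof -
  obtain p where p: "golay_perm p" "p 23 = i"
    using golay_perm_transitive by blast
  then have "p j = i \<longleftrightarrow> j = 23" for j
    by (metis golay_perm_def bij_is_inj injD)
  then have "permute p (one_five i) = one_five 23"
    by (simp add: vec_eq_iff one_five_def)
  then show ?thesis
    using leech_equivI[OF leech_aut_golay_perm[OF p(1)]] by metis
qed

lemma tetrad_0: "tetrad 0 = {23, 0, 1, 2}"
  and tetrad_1: "tetrad 1 = {3, 5, 14, 17}"
proof -
  have idx: "idx 23 = 23" "idx 0 = 0" "idx 1 = 1" "idx 2 = 2" "idx 3 = 3" "idx 5 = 5" "idx 14 = 14" "idx 17 = 17"
    using idx_of_nat[of 23] idx_of_nat[of 0] idx_of_nat[of 1] idx_of_nat[of 2] idx_of_nat[of 3]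
      idx_of_nat[of 5] idx_of_nat[of 14] idx_of_nat[of 17] by simp_all
  have sub: "{23, 0, 1, 2} \<subseteq> tetrad 0" "{3, 5, 14, 17} \<subseteq> tetrad 1"
    by (simp_all add: tetrad_def tet_def idx sextet_def)
  show "tetrad 0 = {23, 0, 1, 2}"
    by (rule card_subset_eq[OF _ sub(1), symmetric]) (simp_all add: card_tetrad)
  show "tetrad 1 = {3, 5, 14, 17}"
    by (rule card_subset_eq[OF _ sub(2), symmetric]) (simp_all add: card_tetrad)
qed

text \<open>With the three entries -3 placed at infinity, 0 and 1, tetrad 0 has half-sum -4, and the
  map gives -1 three times and -5 at 2. The other tetrads have half-sum 2 and give -1 throughout. A
  global sign change finishes the computation.\<close>

lemma minus_threes_equiv:
  assumes "card B = 3"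
  shows "leech_equiv (minus_threes B) (one_five 23)"
proof -
  let ?B = "{23, 0, 1} :: 24 set"
  obtain p where p: "golay_perm p" "p ` ?B = B"
    using golay_perm_3_homogeneous[OF assms] by blast
  then have "p j \<in> B \<longleftrightarrow> j \<in> ?B" for j
    by (metis golay_perm_def bij_is_inj inj_image_mem_iff)
  then have "permute p (minus_threes B) = minus_threes ?B"
    by (simp add: vec_eq_iff minus_threes_def)
  then have "leech_equiv (minus_threes B) (minus_threes ?B)"
    using leech_equivI[OF leech_aut_golay_perm[OF p(1)]] by metis
  moreover have "sextet_map (minus_threes ?B) = - one_five 2"
  proof -
    have "sextet_map (minus_threes ?B) $ i = - one_five 2 $ i" for i
    proof (cases "tet i = 0")
      case True
      then have "i \<in> {23, 0, 1, 2}" by (simp flip: tetrad_0 add: tetrad_def)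
      then show ?thesis
        using True by (auto simp: sextet_map_nth tetrad_0 minus_threes_def one_five_def)
    next
      case False
      then have "i \<notin> {23, 0, 1, 2}" by (simp flip: tetrad_0 add: tetrad_def)
      moreover have "j \<notin> ?B" if "j \<in> tetrad (tet i)" for j
      proof -
        have "j \<notin> tetrad 0" using that False by (simp add: tetrad_def)
        then show ?thesis unfolding tetrad_0 by blast
      qed
      then have "(\<Sum>j\<in>tetrad (tet i). minus_threes ?B $ j) = (\<Sum>j\<in>tetrad (tet i). 1)"
        by (intro sum.cong) (auto simp: minus_threes_def)
      ultimately show ?thesis
        using False by (simp add: sextet_map_nth card_tetrad tet_less minus_threes_def one_five_def)
    qed
    then show ?thesis by (simp add: vec_eq_iff)
  qed
  then have "leech_equiv (minus_threes ?B) (- one_five 2)"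
    using leech_equivI[OF leech_aut_sextet_map] by metis
  moreover have "flip_signs (\<lambda>_. True) (- one_five 2) = one_five 2"
    by (simp add: vec_eq_iff flip_signs_def)
  then have "leech_equiv (- one_five 2) (one_five 2)"
    using leech_equivI[OF leech_aut_flip_signs[of "\<lambda>_. True"], of "- one_five 2"] word_const_in_golay[of 1]
    by simp
  ultimately show ?thesis
    using one_five_equiv leech_equiv_trans by blast
qed

lemma leech_shell_norm:
  assumes "x \<in> leech_shell n" "\<And>i. x $ i = of_int (a i)"
  shows "(\<Sum>i\<in>UNIV. a i * a i) = 16 * int n"
proof -
  have "real_of_int (\<Sum>i\<in>UNIV. a i * a i) = x \<bullet> x"
    by (simp add: inner_vec_def assms(2))
  also have "\<dots> = real_of_int (16 * int n)"
    using assms(1) by (simp add: leech_shell_def)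
  finally show ?thesis by linarith
qed

text \<open>One odd coordinate suffices as hypothesis, since all have the same parity. After the
  sign change the coordinates are \<open>1 + 4 * e i\<close>, and norm 48 becomes
  \<open>e i * (2 * e i + 1)\<close> summing to 3. This term is 0, 3 or 1 for \<open>e i\<close>
  equal to 0, 1 or -1 and exceeds 3 otherwise, so there is one entry 5 or there are three entries
  -3.\<close>

lemma odd_shell_3_equiv:
  assumes v: "v \<in> leech_shell 3" and "v $ i0 = of_int n0" "odd n0"
  shows "leech_equiv v (one_five 23)"
proof -
  obtain m c where x: "\<And>i. v $ i = of_int (m + 2 * c i)" and c: "word c \<in> golay_code"
    using v unfolding leech_shell_def leech_lattice_iff by blast
  have "real_of_int n0 = of_int (m + 2 * c i0)"
    using assms(2) x by metis
  then have "n0 = m + 2 * c i0" by linarith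
  then have "odd m" using \<open>odd n0\<close> by simp
  then obtain l where l: "m = 2 * l + 1" by (elim oddE)
  \<comment> \<open>Adding the constant \<open>l\<close> to \<open>c\<close> normalizes
    \<open>m\<close> to 1; a constant word is in the code.\<close>
  define d where "d i = c i + l" for i
  have xd: "v $ i = of_int (1 + 2 * d i)" for i
    by (simp add: x l d_def)
  have "word d \<in> golay_code"
    unfolding d_def word_add by (intro golay_code_add c word_const_in_golay)
  also have "word d = word (\<lambda>i. of_bool (odd (d i)))"
    by (intro word_cong) simp
  finally have "leech_aut (flip_signs (\<lambda>i. odd (d i)))"
    by (rule leech_aut_flip_signs)
  then have equiv: "leech_equiv v (flip_signs (\<lambda>i. odd (d i)) v)"
    by (rule leech_equivI)
  define w where "w = flip_signs (\<lambda>i. odd (d i)) v"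
  define e where "e i = (if odd (d i) then - ((1 + d i) div 2) else d i div 2)" for i
  have w: "w $ i = of_int (1 + 4 * e i)" for i
  proof (cases "odd (d i)")
    case True
    then obtain k where "d i = 2 * k + 1" by (elim oddE)
    then show ?thesis by (simp add: w_def flip_signs_def e_def xd)
  next
    case False
    then obtain k where "d i = 2 * k" by (auto elim: evenE)
    then show ?thesis by (simp add: w_def flip_signs_def e_def xd)
  qed
  have "w \<in> leech_shell 3"
    using equiv v leech_equiv_shell unfolding w_def by blast
  then have "(\<Sum>i\<in>UNIV. (1 + 4 * e i) * (1 + 4 * e i)) = 48"
    using leech_shell_norm[of w 3 "\<lambda>i. 1 + 4 * e i"] w by simp
  also have "(\<Sum>i\<in>UNIV. (1 + 4 * e i) * (1 + 4 * e i)) = (\<Sum>i\<in>(UNIV :: 24 set). 1 + 8 * (e i * (2 * e i + 1)))"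
    by (intro sum.cong) (simp_all add: algebra_simps)
  also have "\<dots> = 24 + 8 * (\<Sum>i\<in>UNIV. e i * (2 * e i + 1))"
    by (simp add: sum.distrib flip: sum_distrib_left)
  finally have sum3: "(\<Sum>i\<in>UNIV. e i * (2 * e i + 1)) = 3" by simp
  have nonneg: "0 \<le> k * (2 * k + 1)" for k :: int
    by (cases "k \<ge> 0") (simp_all add: zero_le_mult_iff)
  have e: "e i = 0 \<or> e i = 1 \<or> e i = - 1" for i
  proof -
    have "e i * (2 * e i + 1) \<le> 3"
      unfolding sum3[symmetric] by (rule member_le_sum) (simp_all add: nonneg)
    moreover have "4 \<le> e i * (2 * e i + 1)" if "e i \<ge> 2"
      using mult_mono[of 2 "e i" 2 "2 * e i + 1"] that by simp
    moreover have "4 \<le> e i * (2 * e i + 1)" if "e i \<le> - 2"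
      using mult_mono[of 2 "- e i" 2 "- (2 * e i + 1)"] that by (simp add: algebra_simps)
    ultimately show ?thesis by linarith
  qed
  define A where "A = {i. e i = 1}"
  define B where "B = {i. e i = - 1}"
  have "e i * (2 * e i + 1) = 3 * of_bool (i \<in> A) + of_bool (i \<in> B)" for i
    using e[of i] by (auto simp: A_def B_def)
  then have "(\<Sum>i\<in>UNIV. 3 * of_bool (i \<in> A) + of_bool (i \<in> B)) = (3 :: int)"
    using sum3 by simp
  then have "3 * int (card A) + int (card B) = 3"
    by (simp add: sum.distrib flip: sum_distrib_left)
  then have "card A = 1 \<and> card B = 0 \<or> card A = 0 \<and> card B = 3"
    by presburger
  then consider "card A = 1" "card B = 0" | "card A = 0" "card B = 3"
    by metis
  then have "leech_equiv w (one_five 23)"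
  proof cases
    case 1
    then obtain i where "A = {i}" "B = {}" by (auto simp: card_1_singleton_iff)
    then have "w = one_five i"
      using e by (auto simp: vec_eq_iff w one_five_def A_def B_def)
    then show ?thesis using one_five_equiv by simp
  next
    case 2
    then have "A = {}" by simp
    then have "w = minus_threes B"
      using e by (auto simp: vec_eq_iff w minus_threes_def A_def B_def)
    then show ?thesis using minus_threes_equiv 2 by simp
  qed
  then show ?thesis
    using equiv leech_equiv_trans unfolding w_def by blast
qed

text \<open>For \<open>v = 2d\<close>, the image under \<open>sextet_map\<close> has at 3 the value
  \<open>2 * d 3\<close> minus the sum of \<open>d\<close> over tetrad 1. An odd sum over tetrad 1
  therefore suffices, and as this tetrad avoids infinity, \<open>shift\<close> moves any of its
  translates onto it. If all translates had even sums, \<open>d\<close> would have constant parity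
  on the finite coordinates, which norm 12 excludes.\<close>

lemma shell_3_equiv:
  assumes v: "v \<in> leech_shell 3"
  shows "leech_equiv v (one_five 23)"
proof -
  obtain m c where x: "\<And>i. v $ i = of_int (m + 2 * c i)"
    and c: "4 dvd (\<Sum>i\<in>UNIV. c i) - 2 * m" "word c \<in> golay_code"
    using v unfolding leech_shell_def leech_lattice_iff by blast
  show ?thesis
  proof (cases "odd m")
    case True
    then show ?thesis using odd_shell_3_equiv[OF v x[of 0]] by simp
  next
    case False
    then obtain l where l: "m = 2 * l" by (auto elim: evenE)
    define d where "d i = l + c i" for i
    have xd: "v $ i = of_int (2 * d i)" for i
      by (simp add: x l d_def)
    have "word d = word c + word (\<lambda>i. l)"
      unfolding d_def word_add[symmetric] by (intro word_cong) auto
    then have d_golay: "word d \<in> golay_code"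
      using c(2) by (simp add: golay_code_add word_const_in_golay)
    have "(\<Sum>i\<in>UNIV. d i) = ((\<Sum>i\<in>UNIV. c i) - 2 * m) + 4 * (7 * l)"
      by (simp add: d_def sum.distrib l)
    then have sum_d: "4 dvd (\<Sum>i\<in>UNIV. d i)"
      using c(1) by (metis dvd_add dvd_triv_left)
    have "4 * (\<Sum>i\<in>UNIV. d i * d i) = 48"
      using leech_shell_norm[OF v xd] by (simp add: sum_distrib_left mult_ac)
    then have norm_d: "(\<Sum>i\<in>UNIV. d i * d i) = 12" by simp
    have "\<exists>k. odd (d (of_nat ((3 + k) mod 23)) + d (of_nat ((5 + k) mod 23)) +
        d (of_nat ((14 + k) mod 23)) + d (of_nat ((17 + k) mod 23)))"
    proof (rule ccontr)
      assume "\<not> ?thesis"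
      then have parity: "even (d (of_nat n)) \<longleftrightarrow> even (d (of_nat 0))" if "n < 23" for n
        using that by (intro shift_parity[of "\<lambda>n. d (of_nat n)"]) auto
      have weight: "4 dvd (\<Sum>n<23. of_bool (odd (d (of_nat n)))) + (of_bool (odd (d 23)) :: int)"
        using golay_weight_word[OF d_golay] unfolding sum_24_of_nat .
      show False
      proof (cases "even (d (of_nat 0))")
        \<comment> \<open>At most the coordinate at infinity is odd, and weights are divisible by 4,
          so all of \<open>d\<close> is even. Then \<open>d = 2e\<close> with an odd sum of squares
          3 but an even sum of entries, contrary to \<open>e * e\<close> and \<open>e\<close> having
          the same parity.\<close>
        case True
        then have "(\<Sum>n<23. of_bool (odd (d (of_nat n)))) = (0 :: int)"
          using parity by simp
        then have "even (d 23)"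
          using weight by (auto split: if_splits)
        then have even_d: "even (d i)" for i
          using parity True by (cases rule: coord_cases[of i]) auto
        define e where "e i = d i div 2" for i
        have e: "d i = 2 * e i" for i
          using even_d[of i] by (simp add: e_def)
        have "4 * (\<Sum>i\<in>UNIV. e i * e i) = 12"
          using norm_d by (simp add: e sum_distrib_left mult_ac)
        then have "odd (\<Sum>i\<in>UNIV. e i * e i)" by presburger
        moreover have "(\<Sum>i\<in>UNIV. d i) = 2 * (\<Sum>i\<in>UNIV. e i)"
          by (simp add: e sum_distrib_left)
        then have "even (\<Sum>i\<in>UNIV. e i)"
          using sum_d by presburger
        moreover have "even ((\<Sum>i\<in>UNIV. e i * e i) - (\<Sum>i\<in>UNIV. e i))"
          unfolding sum_subtractf[symmetric] by (intro dvd_sum) simp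
        ultimately show False by simp
      next
        case False
        \<comment> \<open>Odd entries are nonzero: 23 of them have squares summing to at least 23,
          more than 12.\<close>
        have "1 \<le> d (of_nat n) * d (of_nat n)" if "n < 23" for n
        proof -
          have "d (of_nat n) \<noteq> 0" using False parity[OF that] by auto
          then show ?thesis by (auto simp: int_one_le_iff_zero_less zero_less_mult_iff)
        qed
        then have "(\<Sum>n<23::nat. 1) \<le> (\<Sum>n<23. d (of_nat n) * d (of_nat n))"
          by (intro sum_mono) simp
        moreover have "0 \<le> d 23 * d 23" by simp
        ultimately show False
          using norm_d unfolding sum_24_of_nat by simp
      qed
    qed
    then obtain k where k: "odd (d (of_nat ((3 + k) mod 23)) + d (of_nat ((5 + k) mod 23)) +
        d (of_nat ((14 + k) mod 23)) + d (of_nat ((17 + k) mod 23)))" ..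
    define p where "p = shift ^^ k"
    have p: "golay_perm p"
      unfolding p_def by (intro golay_perm_funpow golay_perm_shift)
    have "p 3 = of_nat ((3 + k) mod 23)" "p 5 = of_nat ((5 + k) mod 23)"
      "p 14 = of_nat ((14 + k) mod 23)" "p 17 = of_nat ((17 + k) mod 23)"
      using shift_pow_of_nat[of 3 k] shift_pow_of_nat[of 5 k] shift_pow_of_nat[of 14 k] shift_pow_of_nat[of 17 k]
      by (simp_all add: p_def)
    then have odd_p: "odd (d (p 3) + d (p 5) + d (p 14) + d (p 17))"
      using k by simp
    define w where "w = sextet_map (permute p v)"
    have equiv: "leech_equiv v w"
      unfolding w_def
      by (meson leech_equivI leech_equiv_trans leech_aut_golay_perm p leech_aut_sextet_map)
    have "tet 3 = 1"
      using tetrad_1 by (metis insertI1 tet_in_tetrad)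
    moreover have "(\<Sum>j\<in>{3, 5, 14, 17}. d (p j)) = d (p 3) + d (p 5) + d (p 14) + d (p 17)"
      by simp
    ultimately have "w $ 3 = of_int (2 * d (p 3) - (d (p 3) + d (p 5) + d (p 14) + d (p 17)))"
      unfolding w_def sextet_map_nth
      by (simp only: tetrad_1) (simp add: xd)
    moreover have "odd (2 * d (p 3) - (d (p 3) + d (p 5) + d (p 14) + d (p 17)))"
      using odd_p by presburger
    ultimately have "leech_equiv w (one_five 23)"
      using odd_shell_3_equiv leech_equiv_shell equiv v by blast
    then show ?thesis
      using equiv leech_equiv_trans by blast
  qed
qed

subsection \<open>The projection onto an octad\<close>

lemma leech_aut_inverse:
  assumes "leech_aut g"
  obtains h where "leech_aut h" "\<And>x. h (g x) = x" "\<And>x. g (h x) = x"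
proof -
  have g: "orthogonal_transformation g" "g ` leech_lattice = leech_lattice"
    using assms by (auto simp: leech_aut_def)
  define h where "h = inv_into UNIV g"
  have inv: "h (g x) = x" "g (h x) = x" for x
    using orthogonal_transformation_bij[OF g(1)]
    by (simp_all add: h_def bij_is_inj bij_is_surj surj_f_inv_f)
  have "orthogonal_transformation h"
    unfolding h_def by (rule orthogonal_transformation_inv[OF g(1)])
  moreover have "h ` leech_lattice = h ` g ` leech_lattice"
    by (simp only: g(2))
  then have "h ` leech_lattice = leech_lattice"
    by (simp add: image_image inv)
  ultimately show ?thesis
    using that inv by (simp add: leech_aut_def)
qed

lemma leech_equiv_sym: "leech_equiv x y \<Longrightarrow> leech_equiv y x"
  unfolding leech_equiv_def by (metis leech_aut_inverse)

lemma group_closure_image_subset: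
  assumes "\<And>x y. g (x - y) = g x - g y" "g ` S \<subseteq> group_closure T"
  shows "g ` group_closure S \<subseteq> group_closure T"
proof -
  have "g x \<in> group_closure T" if "x \<in> group_closure S" for x
    using that
  proof induction
    case (base x)
    \<comment> \<open>The base rule of \<open>group_closure\<close> also provides 0, which need not
      be a generator.\<close>
    moreover have "g 0 = 0" using assms(1)[of 0 0] by simp
    ultimately show ?case using assms(2) by auto
  next
    case (diff x y)
    then show ?case by (simp add: assms(1) group_closure.diff)
  qed
  then show ?thesis by blast
qed

text \<open>Automorphisms preserve the minimal shell, so a decomposition of \<open>v\<close> becomes
  one of \<open>g v\<close> and generators go to generators.\<close>

lemma lattice276_leech_aut_subset:
  assumes "leech_aut g"
  shows "g ` lattice276 v \<subseteq> lattice276 (g v)"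
proof -
  have "linear g"
    using assms by (simp add: leech_aut_def orthogonal_transformation_def)
  note lin = linear_diff[OF this] linear_add[OF this] linear_neg[OF this]
  have "g u \<in> U552 (g v)" if u: "u \<in> U552 v" for u
  proof -
    obtain y z where yz: "y \<in> leech_shell 2" "z \<in> leech_shell 2" "v = y + z" "u = y - z \<or> u = - (y - z)"
      using u unfolding U552_def by (elim CollectE bexE conjE)
    have "g y \<in> leech_shell 2" "g z \<in> leech_shell 2"
      using yz leech_aut_shell[OF assms] by blast+
    moreover have "g v = g y + g z \<and> (g u = g y - g z \<or> g u = - (g y - g z))"
      using yz by (auto simp: lin)
    ultimately show ?thesis
      unfolding U552_def by blast
  qed
  then show ?thesis
    unfolding lattice276_def
    by (intro group_closure_image_subset lin(1)) (auto intro: group_closure.base)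
qed

lemma lattice276_leech_aut:
  assumes "leech_aut g"
  shows "g ` lattice276 v = lattice276 (g v)"
proof
  obtain h where h: "leech_aut h" "\<And>x. h (g x) = x" "\<And>x. g (h x) = x"
    using leech_aut_inverse[OF assms] by blast
  have "h ` lattice276 (g v) \<subseteq> lattice276 v"
    using lattice276_leech_aut_subset[OF h(1), of "g v"] by (simp add: h(2))
  then have "g ` h ` lattice276 (g v) \<subseteq> g ` lattice276 v"
    by blast
  then show "lattice276 (g v) \<subseteq> g ` lattice276 v"
    by (simp add: image_image h(3))
qed (rule lattice276_leech_aut_subset[OF assms])

lemma orthogonal_projection_eqI:
  assumes "subspace W" "y \<in> W" "\<And>w. w \<in> W \<Longrightarrow> orthogonal (x - y) w"
  shows "orthogonal_projection W x = y"
  unfolding orthogonal_projection_def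
proof (rule the_equality)
  fix z assume z: "z \<in> W \<and> (\<forall>w\<in>W. orthogonal (x - z) w)"
  then have "z - y \<in> W" using assms subspace_diff by blast
  then have "orthogonal (x - y) (z - y)" "orthogonal (x - z) (z - y)"
    using z assms(3) by auto
  then have "(z - y) \<bullet> (z - y) = 0"
    unfolding orthogonal_def by (simp add: inner_diff_left inner_diff_right)
  then show "z = y" by simp
qed (use assms in simp)

section \<open>The E8 lattice: coordinates and generators\<close>

text \<open>Eight copies of \<open>m / 2\<close> add up to \<open>4 * m\<close>, so the parity
  condition falls on \<open>n\<close> alone. An arbitrary integer \<open>m\<close> treats both
  cosets at once and fits the form \<open>m + 2c\<close> of Leech vectors.\<close>

lemma E8_lattice_iff:
  "x \<in> E8_lattice \<longleftrightarrow> (\<exists>m n. (\<forall>j. x $ j = of_int m / 2 + of_int (n j)) \<and> even (\<Sum>j\<in>UNIV. n j))"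
proof
  assume "x \<in> E8_lattice"
  then have x: "(\<forall>j. x $ j \<in> \<int>) \<or> (\<forall>j. x $ j - 1 / 2 \<in> \<int>)"
    and "\<exists>k :: int. (\<Sum>j\<in>UNIV. x $ j) = 2 * of_int k"
    by (auto simp: E8_lattice_def)
  then obtain k :: int where k: "(\<Sum>j\<in>UNIV. x $ j) = 2 * of_int k" by blast
  have "\<exists>m. m \<in> {0, 1} \<and> (\<forall>j. x $ j - of_int m / 2 \<in> \<int>)"
    using x by (elim disjE) (rule exI[of _ 0] exI[of _ 1], simp)+
  then obtain m :: int where m: "\<And>j. x $ j - of_int m / 2 \<in> \<int>" by blast
  define n where "n j = \<lfloor>x $ j - of_int m / 2\<rfloor>" for j
  have n: "x $ j = of_int m / 2 + of_int (n j)" for j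
    using m[of j] by (auto simp: n_def elim!: Ints_cases)
  have "(\<Sum>j\<in>UNIV. x $ j) = of_int (4 * m + (\<Sum>j\<in>UNIV. n j))"
    by (simp add: n sum.distrib)
  then have "real_of_int (4 * m + (\<Sum>j\<in>UNIV. n j)) = of_int (2 * k)"
    using k by simp
  then have "4 * m + (\<Sum>j\<in>UNIV. n j) = 2 * k"
    unfolding of_int_eq_iff .
  then have "even (\<Sum>j\<in>UNIV. n j)" by presburger
  with n show "\<exists>m n. (\<forall>j. x $ j = of_int m / 2 + of_int (n j)) \<and> even (\<Sum>j\<in>UNIV. n j)" by blast
next
  assume "\<exists>m n. (\<forall>j. x $ j = of_int m / 2 + of_int (n j)) \<and> even (\<Sum>j\<in>UNIV. n j)"
  then obtain m n where n: "\<And>j. x $ j = of_int m / 2 + of_int (n j)" and "even (\<Sum>j\<in>UNIV. n j)" by blast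
  then obtain k where k: "(\<Sum>j\<in>UNIV. n j) = 2 * k" by (elim evenE)
  have "(\<Sum>j\<in>UNIV. x $ j) = of_int (4 * m + (\<Sum>j\<in>UNIV. n j))"
    by (simp add: n sum.distrib)
  then have "(\<Sum>j\<in>UNIV. x $ j) = 2 * of_int (2 * m + k)"
    by (simp add: k)
  moreover have "(\<forall>j. x $ j \<in> \<int>) \<or> (\<forall>j. x $ j - 1 / 2 \<in> \<int>)"
  proof (cases "even m")
    case True
    then obtain l where "m = 2 * l" by (elim evenE)
    then show ?thesis by (simp add: n)
  next
    case False
    then obtain l where "m = 2 * l + 1" by (elim oddE)
    then have "x $ j - 1 / 2 = of_int (l + n j)" for j by (simp add: n field_simps)
    then show ?thesis by (metis Ints_of_int)
  qed
  ultimately show "x \<in> E8_lattice" unfolding E8_lattice_def by blast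
qed

lemma E8_latticeI:
  "(\<And>j. x $ j = of_int m / 2 + of_int (n j)) \<Longrightarrow> even (\<Sum>j\<in>UNIV. n j) \<Longrightarrow> x \<in> E8_lattice"
  unfolding E8_lattice_iff by blast

lemma E8_lattice_diff:
  assumes "x \<in> E8_lattice" "y \<in> E8_lattice"
  shows "x - y \<in> E8_lattice"
proof -
  obtain m n m' n' where "\<And>j. x $ j = of_int m / 2 + of_int (n j)" "even (\<Sum>j\<in>UNIV. n j)"
    "\<And>j. y $ j = of_int m' / 2 + of_int (n' j)" "even (\<Sum>j\<in>UNIV. n' j)"
    using assms unfolding E8_lattice_iff by blast
  then show ?thesis
    by (intro E8_latticeI[of _ "m - m'" "\<lambda>j. n j - n' j"]) (simp_all add: sum_subtractf diff_divide_distrib)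
qed

lemma E8_lattice_0: "0 \<in> E8_lattice"
  by (rule E8_latticeI[of _ 0 "\<lambda>_. 0"]) simp_all

text \<open>Subtract \<open>m\<close> times the all-halves vector; the rest is an integer vector
  \<open>n\<close> with even sum \<open>2 * k\<close>. It equals the combination of the differences
  with coefficients \<open>n j\<close>, plus \<open>k\<close> times twice the unit vector at
  \<open>j0\<close>.\<close>

lemma E8_lattice_subset:
  assumes diff: "\<And>x y. x \<in> H \<Longrightarrow> y \<in> H \<Longrightarrow> x - y \<in> H"
    and roots: "\<And>j. axis j 1 - axis j0 1 \<in> H"
    and double: "2 *\<^sub>R axis j0 1 \<in> H"
    and half: "(\<chi> j. 1 / 2) \<in> H"
  shows "E8_lattice \<subseteq> H"
proof
  have zero: "0 \<in> H" using diff[OF half half] by simp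
  have neg: "- x \<in> H" if "x \<in> H" for x using diff[OF zero that] by simp
  have add: "x + y \<in> H" if "x \<in> H" "y \<in> H" for x y using diff[OF that(1) neg[OF that(2)]] by simp
  have nat: "real k *\<^sub>R x \<in> H" if "x \<in> H" for x k
    by (induction k) (simp_all add: zero add that scaleR_left_distrib)
  have int: "real_of_int k *\<^sub>R x \<in> H" if "x \<in> H" for x k
    using nat[OF that] neg by (cases k rule: int_cases2) auto
  have sum: "(\<Sum>j\<in>A. f j) \<in> H" if "finite A" "\<And>j. j \<in> A \<Longrightarrow> f j \<in> H" for f and A :: "8 set"
    using that by (induction rule: finite_induct) (simp_all add: zero add)
  fix x :: "real ^ 8" assume "x \<in> E8_lattice"
  then obtain m n where n: "\<And>j. x $ j = of_int m / 2 + of_int (n j)" "even (\<Sum>j\<in>UNIV. n j)"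
    unfolding E8_lattice_iff by blast
  then obtain k where k: "(\<Sum>j\<in>UNIV. n j) = 2 * k" by (elim evenE)
  have *: "of_int m *\<^sub>R (\<chi> j. 1 / 2) + (\<Sum>j\<in>UNIV. of_int (n j) *\<^sub>R (axis j 1 - axis j0 1)) + of_int k *\<^sub>R (2 *\<^sub>R axis j0 1) \<in> H"
    by (intro add int sum roots double half) simp
  have "(\<Sum>j\<in>UNIV. real_of_int (n j) *\<^sub>R (axis j 1 - axis j0 1 :: real ^ 8)) $ i =
      of_int (n i) - of_int (2 * k) * axis j0 1 $ i" for i
  proof -
    have "(\<Sum>j\<in>UNIV. real_of_int (n j) *\<^sub>R (axis j 1 - axis j0 1 :: real ^ 8)) $ i =
        (\<Sum>j\<in>UNIV. (if j = i then of_int (n j) else 0) - of_int (n j) * axis j0 1 $ i)"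
      unfolding sum_component by (intro sum.cong) (auto simp: axis_def)
    also have "\<dots> = of_int (n i) - of_int (\<Sum>j\<in>UNIV. n j) * axis j0 1 $ i"
      by (simp add: sum_subtractf sum_distrib_right)
    finally show ?thesis by (simp only: k)
  qed
  then have "of_int m *\<^sub>R (\<chi> j. 1 / 2) + (\<Sum>j\<in>UNIV. of_int (n j) *\<^sub>R (axis j 1 - axis j0 1)) + of_int k *\<^sub>R (2 *\<^sub>R axis j0 1) = x"
    by (simp add: vec_eq_iff n(1))
  with * show "x \<in> H" by simp
qed

section \<open>Certificates for minimal vectors that decompose \<open>base_vec\<close>\<close>

definition int_vec :: "int \<Rightarrow> int list \<Rightarrow> real ^ 24" where
  "int_vec m l = (\<chi> i. of_int (m + 2 * (l ! idx i)))"

definition leech_cert :: "int \<Rightarrow> int list \<Rightarrow> nat list \<Rightarrow> bool" where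
  "leech_cert m l I \<longleftrightarrow> length l = 24 \<and> (sum_list l - 2 * m) mod 4 = 0 \<and> golay_cert I (map odd l)"

lemma leech_certD:
  assumes "leech_cert m l I"
  shows "int_vec m l \<in> leech_lattice"
proof (rule leech_latticeI)
  have l: "length l = 24" "(sum_list l - 2 * m) mod 4 = 0" "golay_cert I (map odd l)"
    using assms by (simp_all add: leech_cert_def)
  show "int_vec m l $ i = of_int (m + 2 * (l ! idx i))" for i
    by (simp add: int_vec_def)
  show "4 dvd (\<Sum>i\<in>UNIV. l ! idx i) - 2 * m"
    using l sum_nth_idx[of l "\<lambda>x. x"] by (simp add: mod_eq_0_iff_dvd)
  have "bool_word (map odd l) = word (\<lambda>i. l ! idx i)"
    using l by (simp add: vec_eq_iff bool_word_def)
  then show "word (\<lambda>i. l ! idx i) \<in> golay_code"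
    using golay_certD[OF l(3)] by simp
qed

lemma int_vec_inner:
  assumes "length k = 24" "length l = 24"
  shows "int_vec m k \<bullet> int_vec n l = of_int (sum_list (map2 (\<lambda>a b. (m + 2 * a) * (n + 2 * b)) k l))"
proof -
  have "int_vec m k \<bullet> int_vec n l = of_int (\<Sum>i\<in>UNIV. (\<lambda>(a, b). (m + 2 * a) * (n + 2 * b)) (zip k l ! idx i))"
    using assms by (simp add: inner_vec_def int_vec_def)
  also have "(\<Sum>i\<in>UNIV. (\<lambda>(a, b). (m + 2 * a) * (n + 2 * b)) (zip k l ! idx i)) = sum_list (map2 (\<lambda>a b. (m + 2 * a) * (n + 2 * b)) k l)"
    using assms by (subst sum_nth_idx) simp_all
  finally show ?thesis .
qed

definition octad :: "nat list" where
  "octad = [4, 11, 12, 15, 19, 20, 21, 22]"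

text \<open>Half-coordinates of a vector with entry 4 at infinity and entries 2 or -2 on an octad
  disjoint from \<open>octad\<close>; its norm is 16 + 8 * 4 = 48.\<close>

definition base_coords :: "int list" where
  "base_coords = [-1, -1, -1, 0, 0, 0, 0, -1, -1, -1, 0, 0, 0, -1, 0, 0, 0, 1, 0, 0, 0, 0, 0, 2]"

definition base_vec :: "real ^ 24" where
  "base_vec = int_vec 0 base_coords"

lemma base_vec_shell: "base_vec \<in> leech_shell 3"
proof -
  have "leech_cert 0 base_coords [3, 4, 10, 12]" by code_simp
  moreover have "sum_list (map2 (\<lambda>a b. (0 + 2 * a) * (0 + 2 * b)) base_coords base_coords) = 48"
    by code_simp
  moreover have "length base_coords = 24" by (simp add: base_coords_def)
  ultimately show ?thesis
    using leech_certD[of 0 base_coords] int_vec_inner[of base_coords base_coords 0 0]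
    by (simp add: leech_shell_def base_vec_def)
qed

definition minimal_cert :: "int \<Rightarrow> int list \<Rightarrow> nat list \<Rightarrow> bool" where
  "minimal_cert m l I \<longleftrightarrow> leech_cert m l I \<and>
     sum_list (map2 (\<lambda>a b. (m + 2 * a) * (m + 2 * b)) l l) = 32 \<and>
     sum_list (map2 (\<lambda>a b. (m + 2 * a) * (0 + 2 * b)) l base_coords) = 24"

text \<open>Inner product 24 gives \<open>base_vec - y\<close> the norm 48 - 48 + 32 = 32, so it is
  minimal as well, and \<open>2y - base_vec\<close> is the difference of the two summands.\<close>

lemma minimal_certD:
  assumes "minimal_cert m l I"
  shows "2 *\<^sub>R int_vec m l - base_vec \<in> lattice276 base_vec"
proof -
  define y where "y = int_vec m l"
  have len: "length l = 24" "length base_coords = 24"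
    using assms by (simp_all add: minimal_cert_def leech_cert_def base_coords_def)
  have y: "y \<in> leech_lattice" "y \<bullet> y = 32" "y \<bullet> base_vec = 24"
    using assms leech_certD[of m l I] int_vec_inner[OF len(1) len(1), of m m]
      int_vec_inner[OF len(1) len(2), of m 0]
    by (simp_all add: y_def minimal_cert_def base_vec_def)
  have v: "base_vec \<in> leech_lattice" "base_vec \<bullet> base_vec = 48"
    using base_vec_shell by (simp_all add: leech_shell_def)
  have "y \<in> leech_shell 2"
    using y by (simp add: leech_shell_def)
  moreover have "(base_vec - y) \<bullet> (base_vec - y) = 32"
    using y v by (simp add: inner_diff_left inner_diff_right inner_commute)
  then have "base_vec - y \<in> leech_shell 2"
    using y v leech_lattice_diff by (simp add: leech_shell_def)
  moreover have "2 *\<^sub>R y - base_vec = y - (base_vec - y)"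
    by (simp add: scaleR_2)
  ultimately have "2 *\<^sub>R y - base_vec \<in> U552 base_vec"
    unfolding U552_def mem_Collect_eq
    by (intro bexI[of _ y] bexI[of _ "base_vec - y"] conjI disjI1) simp_all
  then show ?thesis
    by (simp add: y_def lattice276_def group_closure.base)
qed

text \<open>An entry \<open>(a, l, I)\<close> stands for the minimal vector \<open>2 l\<close>, which restricts on the octad to
  \<open>2 (e\<^sub>a - e\<^sub>2\<^sub>2)\<close>.\<close>

definition root_certs :: "(nat \<times> int list \<times> nat list) list" where
  "root_certs =
    [(4, [-1, -1, -1, 0, 1, 0, 0, 0, 0, 0, 0, 0, 0, -1, 0, 0, -1, 0, 0, 0, 0, 0, -1, 1], [9, 11, 22]),
     (11, [0, 0, -1, 0, 0, 0, 0, 0, -1, -1, -1, 1, 0, -1, 0, 0, 0, 0, 0, 0, 0, 0, -1, 1], [8, 18, 20]),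
     (12, [-1, 0, -1, 0, 0, -1, 0, -1, 0, -1, 0, 0, 1, 0, 0, 0, 0, 0, 0, 0, 0, 0, -1, 1], [1, 4, 9]),
     (15, [-1, 0, -1, 0, 0, 0, 1, 0, -1, 0, 0, 0, 0, 0, 0, 1, 0, 1, 0, 0, 0, 0, -1, 1], [5, 6, 14]),
     (19, [0, 0, -1, 0, 0, 0, 0, -1, 0, 0, 0, 0, 0, -1, 1, 0, 0, 1, 0, 1, 0, 0, -1, 1], [7, 10, 21]),
     (20, [0, -1, -1, -1, 0, 0, 0, -1, -1, 0, 0, 0, 0, 0, 0, 0, 0, 0, 0, 0, 1, 0, -1, 1], [17, 20, 21]),
     (21, [-1, 0, 0, 0, 0, 0, 0, -1, -1, 0, 0, 0, 0, -1, 0, 0, 0, 0, -1, 0, 0, 1, -1, 1], [0, 9, 19])]"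

text \<open>The last entry of \<open>root_certs\<close> with the signs at 18 and 22 reversed.
  \<open>base_vec\<close> vanishes at both places, so the inner product remains 24; the restriction
  to the octad becomes the sum of the two unit vectors instead of their difference, up to the factor
  2.\<close>

definition sum_root_coords :: "int list" where
  "sum_root_coords = [-1, 0, 0, 0, 0, 0, 0, -1, -1, 0, 0, 0, 0, -1, 0, 0, 0, 0, 1, 0, 0, 1, 1, 1]"

text \<open>With \<open>m = 1\<close> this is the vector with 1 on the octad, 3 at infinity and -1
  elsewhere; it supplies the all-halves vector of E8.\<close>

definition odd_coords :: "int list" where
  "odd_coords = [-1, -1, -1, -1, 0, -1, -1, -1, -1, -1, -1, 0, 0, -1, -1, 0, -1, -1, -1, 0, 0, 0, 0, 1]"

lemma octad_word_in_golay: "word (\<lambda>i. of_bool (idx i \<in> set octad)) \<in> golay_code"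
proof -
  have "golay_cert [0, 6, 9, 14] (map (\<lambda>n. n \<in> set octad) [0..<24])"
    by code_simp
  then have "bool_word (map (\<lambda>n. n \<in> set octad) [0..<24]) \<in> golay_code"
    by (rule golay_certD)
  then show ?thesis unfolding bool_word_map .
qed

lemma base_vec_octad: "idx i \<in> set octad \<Longrightarrow> base_vec $ i = 0"
proof -
  have "list_all (\<lambda>n. base_coords ! n = 0) octad" by code_simp
  then show "idx i \<in> set octad \<Longrightarrow> base_vec $ i = 0"
    by (simp add: list_all_iff base_vec_def int_vec_def)
qed

text \<open>A generator \<open>2y - base_vec\<close> restricts to \<open>2y\<close>, so division by
  4 leaves \<open>m/2 + c\<close>, and the sum of \<open>c\<close> over the octad is even. E8 is
  invariant under permutations of coordinates, so any enumeration \<open>o8\<close> of the octad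
  serves. Conversely, the nine certified vectors supply the generators required by
  \<open>E8_lattice_subset\<close>.\<close>

lemma projection_eq_E8:
  assumes o: "bij_betw o8 (UNIV :: 8 set) {i. idx i \<in> set octad}"
  shows "(\<lambda>x. \<chi> j. x $ o8 j / 4) ` lattice276 base_vec = E8_lattice"
proof
  define F where "F = (\<lambda>x :: real ^ 24. (\<chi> j. x $ o8 j / 4) :: real ^ 8)"
  have F_diff: "F (x - y) = F x - F y" for x y
    by (simp add: F_def vec_eq_iff diff_divide_distrib)
  have o_octad: "idx (o8 j) \<in> set octad" for j
    using o by (auto simp: bij_betw_def)
  have o_inj: "o8 i = o8 j \<longleftrightarrow> i = j" for i j
    using o by (auto simp: bij_betw_def inj_on_def)
  have F_gen: "F (2 *\<^sub>R y - base_vec) $ j = y $ o8 j / 2" for y j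
    by (simp add: F_def base_vec_octad[OF o_octad])
  have min_E8: "F (2 *\<^sub>R y - base_vec) \<in> E8_lattice" if lattice: "y \<in> leech_lattice" for y
  proof -
    obtain m c where y: "\<And>i. y $ i = of_int (m + 2 * c i)"
      and c: "word c \<in> golay_code"
      using lattice unfolding leech_lattice_iff by blast
    have "even (\<Sum>i\<in>UNIV. c i * of_bool (idx i \<in> set octad))"
      by (rule golay_even_product[OF c octad_word_in_golay])
    also have "(\<Sum>i\<in>UNIV. c i * of_bool (idx i \<in> set octad)) = (\<Sum>i\<in>{i. idx i \<in> set octad}. c i)"
      by (intro sum.mono_neutral_cong_right) auto
    also have "\<dots> = (\<Sum>j\<in>UNIV. c (o8 j))"
      by (rule sum.reindex_bij_betw[OF o, symmetric])
    finally show ?thesis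
      by (intro E8_latticeI[of _ m "\<lambda>j. c (o8 j)"]) (simp_all add: F_gen y add_divide_distrib)
  qed
  have gens: "F u \<in> E8_lattice" if u: "u \<in> U552 base_vec" for u
  proof -
    obtain y z where yz: "y \<in> leech_shell 2" "z \<in> leech_shell 2" "base_vec = y + z" "u = y - z \<or> u = - (y - z)"
      using u unfolding U552_def by (elim CollectE bexE conjE)
    have "y - z = 2 *\<^sub>R y - base_vec"
      by (simp add: yz(3) scaleR_2)
    then have "F (y - z) \<in> E8_lattice"
      using min_E8[of y] yz(1) by (simp add: leech_shell_def)
    moreover have "F (- (y - z)) = 0 - F (y - z)"
      by (simp add: F_def vec_eq_iff field_simps)
    ultimately show ?thesis
      using yz(4) E8_lattice_diff[OF E8_lattice_0] by metis
  qed
  have "F x \<in> E8_lattice" if "x \<in> group_closure (U552 base_vec)" for x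
    using that
  proof induction
    case (base x)
    moreover have "F 0 = 0" by (simp add: F_def vec_eq_iff)
    ultimately show ?case using gens E8_lattice_0 by auto
  next
    case (diff x y)
    then show ?case by (simp add: F_diff E8_lattice_diff)
  qed
  then show "(\<lambda>x. \<chi> j. x $ o8 j / 4) ` lattice276 base_vec \<subseteq> E8_lattice"
    unfolding lattice276_def F_def[symmetric] by blast
  let ?H = "F ` lattice276 base_vec"
  have H_diff: "a - b \<in> ?H" if "a \<in> ?H" "b \<in> ?H" for a b
    using that by (auto simp: lattice276_def F_diff[symmetric] intro!: imageI group_closure.diff)
  have min_H: "(\<chi> j. of_int (m + 2 * l ! idx (o8 j)) / 2) \<in> ?H" if cert: "minimal_cert m l I" for m l I
  proof -
    have "F (2 *\<^sub>R int_vec m l - base_vec) = (\<chi> j. of_int (m + 2 * l ! idx (o8 j)) / 2)"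
      unfolding vec_eq_iff F_gen by (simp add: int_vec_def)
    then show ?thesis using minimal_certD[OF cert] by (metis image_eqI)
  qed
  obtain j0 where j0: "idx (o8 j0) = 22"
  proof -
    have "of_nat 22 \<in> {i. idx i \<in> set octad}" by (simp add: octad_def idx_of_nat[of 22, simplified])
    then have "of_nat 22 \<in> range o8" using o by (simp add: bij_betw_def)
    then obtain j where "o8 j = of_nat 22" by (metis rangeE)
    then have "idx (o8 j) = 22" by (simp only: idx_of_nat)
    then show ?thesis using that by blast
  qed
  have o_eq: "i = j \<longleftrightarrow> idx (o8 i) = idx (o8 j)" for i j
    by (simp add: o_inj idx_eq_iff)
  have roots: "axis j 1 - axis j0 1 \<in> ?H" for j
  proof (cases "j = j0")
    case True
    have "F 0 \<in> ?H" by (intro imageI) (simp add: lattice276_def)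
    then show ?thesis using True by (simp add: F_def zero_vec_def)
  next
    case False
    have certs: "list_all (\<lambda>(a, l, I). minimal_cert 0 l I \<and>
        list_all (\<lambda>n. l ! n = (if n = a then 1 else if n = 22 then - 1 else 0)) octad) root_certs"
      by code_simp
    have "list_all (\<lambda>n. n = 22 \<or> n \<in> set (map fst root_certs)) octad"
      by code_simp
    then have "idx (o8 j) \<in> fst ` set root_certs"
      using o_octad[of j] False j0 o_eq[of j j0] by (auto simp: list_all_iff)
    then obtain l I where "(idx (o8 j), l, I) \<in> set root_certs" by auto
    then have cert: "minimal_cert 0 l I"
      and l: "\<And>n. n \<in> set octad \<Longrightarrow> l ! n = (if n = idx (o8 j) then 1 else if n = 22 then - 1 else 0)"
      using certs by (auto simp: list_all_iff)
    have "(\<chi> i. real_of_int (0 + 2 * l ! idx (o8 i)) / 2) = axis j 1 - axis j0 1"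
      using False j0 by (auto simp: vec_eq_iff l[OF o_octad] axis_def o_eq)
    then show ?thesis using min_H[OF cert] by metis
  qed
  have "2 *\<^sub>R axis j0 1 \<in> ?H"
  proof -
    have cert: "minimal_cert 0 sum_root_coords [0, 9, 19]"
      and "list_all (\<lambda>n. sum_root_coords ! n = (if n = 21 \<or> n = 22 then 1 else 0)) octad"
      by code_simp+
    then have l: "\<And>n. n \<in> set octad \<Longrightarrow> sum_root_coords ! n = (if n = 21 \<or> n = 22 then 1 else 0)"
      by (simp add: list_all_iff)
    obtain j where j: "idx (o8 j) = 21"
    proof -
      have "of_nat 21 \<in> {i. idx i \<in> set octad}" by (simp add: octad_def idx_of_nat[of 21, simplified])
      then have "of_nat 21 \<in> range o8" using o by (simp add: bij_betw_def)
      then obtain j where "o8 j = of_nat 21" by (metis rangeE)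
      then have "idx (o8 j) = 21" by (simp only: idx_of_nat)
      then show ?thesis using that by blast
    qed
    have "(\<chi> i. real_of_int (0 + 2 * sum_root_coords ! idx (o8 i)) / 2) = axis j 1 + axis j0 1"
      using j j0 by (auto simp: vec_eq_iff l[OF o_octad] axis_def o_eq)
    then have "axis j 1 + axis j0 1 \<in> ?H"
      using min_H[OF cert] by metis
    \<comment> \<open>Sum minus difference of the two unit vectors leaves twice the one at
      \<open>j0\<close>.\<close>
    then have "(axis j 1 + axis j0 1) - (axis j 1 - axis j0 1) \<in> ?H"
      using H_diff roots by blast
    then show ?thesis by (simp add: scaleR_2)
  qed
  moreover have "(\<chi> j. 1 / 2) \<in> ?H"
  proof -
    have cert: "minimal_cert 1 odd_coords [2, 8, 16]"
      and "list_all (\<lambda>n. odd_coords ! n = 0) octad"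
      by code_simp+
    then have l: "\<And>n. n \<in> set octad \<Longrightarrow> odd_coords ! n = 0"
      by (simp add: list_all_iff)
    have "(\<chi> i. real_of_int (1 + 2 * odd_coords ! idx (o8 i)) / 2) = (\<chi> j. 1 / 2)"
      by (simp add: l[OF o_octad])
    then show ?thesis using min_H[OF cert] by metis
  qed
  ultimately have "E8_lattice \<subseteq> ?H"
    using H_diff roots by (intro E8_lattice_subset[of ?H j0])
  then show "E8_lattice \<subseteq> (\<lambda>x. \<chi> j. x $ o8 j / 4) ` lattice276 base_vec"
    by (simp add: F_def)
qed

theorem theorem1p5:
  fixes v :: "real ^ 24"
  assumes "v \<in> leech_shell 3"
  shows "\<exists>W :: (real ^ 24) set.
           subspace W \<and> dim W = 8 \<and>
           (\<exists>c :: real. c > 0 \<and>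
              lattice_isometric
                ((\<lambda>x. c *\<^sub>R orthogonal_projection W x) ` lattice276 v) E8_lattice)"
proof -
  have "leech_equiv v base_vec"
    using shell_3_equiv[OF assms] shell_3_equiv[OF base_vec_shell] leech_equiv_sym leech_equiv_trans by blast
  then obtain g where g: "leech_aut g" "g v = base_vec"
    by (auto simp: leech_equiv_def)
  obtain h where h: "leech_aut h" "\<And>x. h (g x) = x" "\<And>x. g (h x) = x"
    using leech_aut_inverse[OF g(1)] by blast
  have lin: "linear g" "linear h" and g_inner: "\<And>x y. g x \<bullet> g y = x \<bullet> y"
    using g(1) h(1) by (auto simp: leech_aut_def orthogonal_transformation_def)
  let ?O = "{i :: 24. idx i \<in> set octad}"
  have "?O = of_nat ` set octad"
  proof (intro equalityI subsetI)
    fix i :: 24 assume "i \<in> ?O"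
    then show "i \<in> of_nat ` set octad" by (metis (lifting) imageI mem_Collect_eq of_nat_idx)
  next
    fix i :: 24 assume "i \<in> of_nat ` set octad"
    moreover have "\<forall>n\<in>set octad. n < 24" by (simp add: octad_def)
    ultimately show "i \<in> ?O" by auto
  qed
  moreover have "inj_on (of_nat :: nat \<Rightarrow> 24) (set octad)"
    by (rule inj_on_subset[OF bij_betw_imp_inj_on[OF bij_of_nat_24]]) (simp add: octad_def)
  ultimately have card_O: "card ?O = 8"
    by (simp add: card_image) (simp add: octad_def)
  then obtain o8 :: "8 \<Rightarrow> 24" where o: "bij_betw o8 UNIV ?O"
    using finite_same_card_bij[of "UNIV :: 8 set" ?O] by auto
  define R where "R x = (\<chi> i. if i \<in> ?O then x $ i else 0)" for x :: "real ^ 24"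
  define W0 where "W0 = {x :: real ^ 24. \<forall>i. i \<notin> ?O \<longrightarrow> x $ i = 0}"
  \<comment> \<open>The octad coordinate space is pulled back by \<open>g\<close>; projecting onto
    \<open>W\<close> is then the truncation \<open>R\<close> conjugated by \<open>g\<close>.\<close>
  define W where "W = h ` W0"
  have sub0: "subspace W0"
    by (auto simp: subspace_def W0_def)
  have subW: "subspace W"
    unfolding W_def by (rule linear_subspace_image[OF lin(2) sub0])
  have "dim W0 = 8"
    unfolding W0_def dim_vec_eq[symmetric] by (subst dim_substandard_cart) (rule card_O)
  moreover have "inj_on h (span W0)" by (rule inj_on_inverseI[of _ g]) (rule h(3))
  ultimately have dimW: "dim W = 8"
    unfolding W_def by (simp add: dim_image_eq[OF lin(2)])
  have proj: "orthogonal_projection W x = h (R (g x))" for x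
  proof (rule orthogonal_projection_eqI[OF subW])
    show "h (R (g x)) \<in> W" by (auto simp: W_def W0_def R_def)
    fix w assume "w \<in> W"
    then obtain u where u: "w = h u" "u \<in> W0" by (auto simp: W_def)
    have "(x - h (R (g x))) \<bullet> w = g (x - h (R (g x))) \<bullet> g w"
      by (simp only: g_inner)
    also have "\<dots> = (g x - R (g x)) \<bullet> u"
      by (simp add: linear_diff[OF lin(1)] h(3) u(1))
    also have "\<dots> = 0"
      using u(2) unfolding inner_vec_def by (intro sum.neutral) (auto simp: R_def W0_def)
    finally show "orthogonal (x - h (R (g x))) w" by (simp add: orthogonal_def)
  qed
  \<comment> \<open>A linear map on the whole space that forgets the coordinates off the octad; it
    preserves norms on \<open>W\<close>, which contains the span of the projected lattice.\<close>
  define f where "f = (\<lambda>x. (\<chi> j. g x $ o8 j) :: real ^ 8)"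
  let ?L = "(\<lambda>x. (1 / 4) *\<^sub>R orthogonal_projection W x) ` lattice276 v"
  have "linear f"
    by (rule linearI) (simp_all add: f_def vec_eq_iff linear_add[OF lin(1)] linear_scale[OF lin(1)])
  moreover have "norm (f x) = norm x" if x: "x \<in> span ?L" for x
  proof -
    have "span ?L \<subseteq> W"
    proof (intro span_minimal subW image_subsetI subspace_scale[OF subW])
      show "orthogonal_projection W y \<in> W" for y
        unfolding proj by (auto simp: W_def W0_def R_def)
    qed
    then obtain u where u: "x = h u" "u \<in> W0" using x by (auto simp: W_def)
    have "f x \<bullet> f x = (\<Sum>j\<in>UNIV. u $ o8 j * u $ o8 j)"
      by (simp add: f_def inner_vec_def u(1) h(3))
    also have "\<dots> = (\<Sum>i\<in>?O. u $ i * u $ i)"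
      by (rule sum.reindex_bij_betw[OF o])
    also have "\<dots> = (\<Sum>i\<in>UNIV. u $ i * u $ i)"
      using u(2) by (intro sum.mono_neutral_left) (auto simp: W0_def)
    also have "\<dots> = g x \<bullet> g x"
      by (simp add: inner_vec_def u(1) h(3))
    finally show ?thesis by (simp add: norm_eq_sqrt_inner g_inner)
  qed
  moreover have "f ` ?L = E8_lattice"
  proof -
    have "o8 j \<in> ?O" for j using o by (auto simp: bij_betw_def)
    then have "f ((1 / 4) *\<^sub>R orthogonal_projection W x) = (\<chi> j. g x $ o8 j / 4)" for x
      by (simp add: f_def proj linear_scale[OF lin(1)] h(3) R_def vec_eq_iff)
    then have "f ` ?L = (\<lambda>x. \<chi> j. x $ o8 j / 4) ` (g ` lattice276 v)"
      by (simp add: image_image)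
    also have "g ` lattice276 v = lattice276 base_vec"
      using lattice276_leech_aut[OF g(1)] g(2) by simp
    finally show ?thesis using projection_eq_E8[OF o] by simp
  qed
  ultimately have "lattice_isometric ?L E8_lattice"
    unfolding lattice_isometric_def by blast
  then show ?thesis
    using subW dimW by (intro exI[of _ W] conjI exI[of _ "1 / 4"]) simp_all
qed

end
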